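(* Let $n\ge 1$. The only continuous geodetically convex functions $u:\mathbb{H}^n\to\mathbb{R}$ on the Heisenberg group $\mathbb{H}^n$ are the constant functions.
   Context: The Heisenberg group is $\mathbb{H}^n=\{(x,y,t): x,y\in\mathbb{R}^n,\ t\in\mathbb{R}\}$ with group law $(x,y,t)*(\tilde x,\tilde y,\tilde t)=\bigl(x+\tilde x,\,y+\tilde y,\,t+\tilde t+2\sum_{i=1}^n(\tilde x_i y_i-x_i\tilde y_i)\bigr)$. Its horizontal space at $p$ is the span of $X_i=\partial_{x_i}+2y_i\partial_t$ and $Y_i=\partial_{y_i}-2x_i\partial_t$, $1\le i\le n$, at $p$. An absolutely continuous curve $\Gamma$ in $\mathbb{H}^n$ is horizontal if its velocity lies in the horizontal space for almost every parameter; writing $\Gamma=(x(s),y(s),t(s))$ this means $\dot t=2\sum_{j=1}^n(\dot x_jy_j-\dot y_jx_j)$ almost everywhere. The $\mathbb{H}^n$-length of a horizontal curve $\Gamma:[0,S]\to\mathbb{H}^n$ is the Euclidean length $\int_0^S|\dot\gamma(s)|\,ds$ of its projection $\gamma=(x(s),y(s))$ to $\mathbb{R}^{2n}$. A geodesic connecting two points is a horizontal curve of shortest $\mathbb{H}^n$-length among all horizontal curves connecting them. A function $u:\mathbb{H}^n\to\mathbb{R}$ is geodetically convex if for every $p,q\in\mathbb{H}^n$ and every geodesic $\gamma:[a,b]\to\mathbb{H}^n$ from $p$ to $q$, the composite $u\circ\gamma:[a,b]\to\mathbb{R}$ is convex in the usual real sense. Continuity is with respect to the usual topology of $\mathbb{R}^{2n+1}$.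 *)

theory Defs
  imports "HOL-Analysis.Analysis"
begin

text \<open>A point \<open>(x, y, t)\<close>, with the product (i.e. Euclidean) topology;
  \<open>n = CARD('n) \<ge> 1\<close>.\<close>

type_synonym 'n heis = "(real ^ 'n) \<times> (real ^ 'n) \<times> real"

definition heis_mult :: "'n::finite heis \<Rightarrow> 'n heis \<Rightarrow> 'n heis" where
  "heis_mult = (\<lambda>(x, y, t) (x', y', t').
     (x + x', y + y', t + t' + 2 * (\<Sum>i\<in>UNIV. x' $ i * y $ i - x $ i * y' $ i)))"

definition heis_X :: "'n::finite \<Rightarrow> 'n heis \<Rightarrow> 'n heis" where
  "heis_X i = (\<lambda>(x, y, t). (axis i 1, 0, 2 * y $ i))"

definition heis_Y :: "'n::finite \<Rightarrow> 'n heis \<Rightarrow> 'n heis" where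
  "heis_Y i = (\<lambda>(x, y, t). (0, axis i 1, - 2 * x $ i))"

definition horizontal_space :: "'n::finite heis \<Rightarrow> 'n heis set" where
  "horizontal_space p = span (range (\<lambda>i. heis_X i p) \<union> range (\<lambda>i. heis_Y i p))"

text \<open>The fields \<open>heis_X i\<close>, \<open>heis_Y i\<close> are the left translates of the coordinate
  directions at the identity, and membership in the horizontal space is the usual equation
  for the last component of the velocity.\<close>

lemma heis_X_left_translate:
  "((\<lambda>s. heis_mult p (s *\<^sub>R axis i 1, 0, 0)) has_vector_derivative heis_X i p) (at 0)"
proof (cases p)
  case (fields x y t)
  have "(\<Sum>j\<in>UNIV. axis i (1::real) $ j * y $ j) = y $ i"
    using inner_axis'[of i 1 y] by (simp add: inner_vec_def)
  then have "(\<Sum>j\<in>UNIV. s * (axis i (1::real) $ j * y $ j)) = s * y $ i" for s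
    by (simp add: sum_distrib_left[symmetric])
  then have "heis_mult p (s *\<^sub>R axis i 1, 0, 0) = p + s *\<^sub>R heis_X i p" for s
    by (simp add: fields heis_mult_def heis_X_def mult.assoc)
  then show ?thesis
    by (auto intro!: derivative_eq_intros)
qed

lemma heis_Y_left_translate:
  "((\<lambda>s. heis_mult p (0, s *\<^sub>R axis i 1, 0)) has_vector_derivative heis_Y i p) (at 0)"
proof (cases p)
  case (fields x y t)
  have "(\<Sum>j\<in>UNIV. x $ j * axis i (1::real) $ j) = x $ i"
    using inner_axis[of x i 1] by (simp add: inner_vec_def)
  then have "(\<Sum>j\<in>UNIV. x $ j * (s * axis i (1::real) $ j)) = s * x $ i" for s
    by (simp add: sum_distrib_left[symmetric] mult.left_commute)
  then have "heis_mult p (0, s *\<^sub>R axis i 1, 0) = p + s *\<^sub>R heis_Y i p" for s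
    by (simp add: fields heis_mult_def heis_Y_def sum_negf)
  then show ?thesis
    by (auto intro!: derivative_eq_intros)
qed

lemma horizontal_space_iff:
  "(v, w, \<tau>) \<in> horizontal_space (x, y, t) \<longleftrightarrow>
     \<tau> = 2 * (\<Sum>j\<in>UNIV. v $ j * y $ j - w $ j * x $ j)"
proof
  let ?S = "{(v, w, \<tau>). \<tau> = 2 * (\<Sum>j\<in>UNIV. v $ j * y $ j - w $ j * x $ j)}"
  have lin: "linear (\<lambda>(v, w, \<tau>). \<tau> - 2 * (v \<bullet> y - w \<bullet> x))"
    by (rule linearI) (auto simp: inner_add_left algebra_simps)
  have S: "?S = {u. (\<lambda>(v, w, \<tau>). \<tau> - 2 * (v \<bullet> y - w \<bullet> x)) u = 0}"
    by (auto simp: inner_vec_def sum_subtractf)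
  have "subspace ?S"
    unfolding S by (rule linear_subspace_kernel[OF lin])
  moreover have "range (\<lambda>i. heis_X i (x, y, t)) \<union> range (\<lambda>i. heis_Y i (x, y, t)) \<subseteq> ?S"
    unfolding S by (auto simp: heis_X_def heis_Y_def inner_axis')
  ultimately have "horizontal_space (x, y, t) \<subseteq> ?S"
    unfolding horizontal_space_def by (rule span_minimal[rotated])
  then show "(v, w, \<tau>) \<in> horizontal_space (x, y, t) \<Longrightarrow>
      \<tau> = 2 * (\<Sum>j\<in>UNIV. v $ j * y $ j - w $ j * x $ j)"
    by auto
next
  assume \<tau>: "\<tau> = 2 * (\<Sum>j\<in>UNIV. v $ j * y $ j - w $ j * x $ j)"
  have e: "(\<Sum>j\<in>UNIV. u $ j *\<^sub>R axis j (1::real)) = u" for u :: "real ^ 'a"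
    using basis_expansion[of u] by (simp add: scalar_mult_eq_scaleR)
  have "(v, w, \<tau>) = (\<Sum>j\<in>UNIV. v $ j *\<^sub>R heis_X j (x, y, t) + w $ j *\<^sub>R heis_Y j (x, y, t))"
    by (simp add: prod_eq_iff fst_sum snd_sum heis_X_def heis_Y_def e \<tau> sum_distrib_left
        algebra_simps)
  also have "\<dots> \<in> horizontal_space (x, y, t)"
    unfolding horizontal_space_def
    by (intro span_sum span_add span_scale span_base) auto
  finally show "(v, w, \<tau>) \<in> horizontal_space (x, y, t)" .
qed

text \<open>Here \<open>d\<close> ranges over the finite families of non-overlapping compact subintervals
  \<open>{u..v}\<close> of \<open>{a..b}\<close>; the endpoints \<open>u\<close>, \<open>v\<close> are recovered as \<open>Inf\<close> and \<open>Sup\<close>.\<close>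

definition abs_continuous_on :: "real \<Rightarrow> real \<Rightarrow> (real \<Rightarrow> 'a::real_normed_vector) \<Rightarrow> bool" where
  "abs_continuous_on a b f \<longleftrightarrow>
     (\<forall>\<epsilon>>0. \<exists>\<delta>>0. \<forall>d. d division_of (\<Union>d) \<and> \<Union>d \<subseteq> {a..b} \<and> (\<Sum>k\<in>d. Sup k - Inf k) < \<delta> \<longrightarrow>
        (\<Sum>k\<in>d. norm (f (Sup k) - f (Inf k))) < \<epsilon>)"

text \<open>A curve parametrised by \<open>{a..b}\<close> is a function on \<open>real\<close> of which only the restriction
  to \<open>{a..b}\<close> matters; hence the derivatives within \<open>{a..b}\<close>.\<close>

definition horizontal_curve :: "real \<Rightarrow> real \<Rightarrow> (real \<Rightarrow> 'n::finite heis) \<Rightarrow> bool" where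
  "horizontal_curve a b \<Gamma> \<longleftrightarrow> a \<le> b \<and> abs_continuous_on a b \<Gamma> \<and>
     (AE s\<in>{a..b} in lebesgue.
        \<exists>v. (\<Gamma> has_vector_derivative v) (at s within {a..b}) \<and> v \<in> horizontal_space (\<Gamma> s))"

definition heis_proj :: "'n::finite heis \<Rightarrow> (real ^ 'n) \<times> (real ^ 'n)" where
  "heis_proj = (\<lambda>(x, y, t). (x, y))"

definition heis_speed :: "real \<Rightarrow> real \<Rightarrow> (real \<Rightarrow> 'n::finite heis) \<Rightarrow> real \<Rightarrow> real" where
  "heis_speed a b \<Gamma> s = norm (vector_derivative (heis_proj \<circ> \<Gamma>) (at s within {a..b}))"

definition heis_length :: "real \<Rightarrow> real \<Rightarrow> (real \<Rightarrow> 'n::finite heis) \<Rightarrow> real" where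
  "heis_length a b \<Gamma> = (LINT s:{a..b}|lebesgue. heis_speed a b \<Gamma> s)"

definition heis_geodesic ::
    "real \<Rightarrow> real \<Rightarrow> (real \<Rightarrow> 'n::finite heis) \<Rightarrow> 'n heis \<Rightarrow> 'n heis \<Rightarrow> bool" where
  "heis_geodesic a b \<Gamma> p q \<longleftrightarrow>
     horizontal_curve a b \<Gamma> \<and> \<Gamma> a = p \<and> \<Gamma> b = q \<and>
     (\<forall>c d \<Delta>. horizontal_curve c d \<Delta> \<and> \<Delta> c = p \<and> \<Delta> d = q \<longrightarrow>
        heis_length a b \<Gamma> \<le> heis_length c d \<Delta>)"

definition constant_speed :: "real \<Rightarrow> real \<Rightarrow> (real \<Rightarrow> 'n::finite heis) \<Rightarrow> bool" where
  "constant_speed a b \<Gamma> \<longleftrightarrow> (\<exists>c. AE s\<in>{a..b} in lebesgue. heis_speed a b \<Gamma> s = c)"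

text \<open>Length does not see the parametrisation, but convexity of \<open>u \<circ> \<Gamma>\<close> does: as usual,
  geodesics are parametrised proportionally to arc length. Demanding convexity along every
  reparametrisation would force \<open>u\<close> to be constant for trivial reasons.\<close>

definition geodetically_convex :: "('n::finite heis \<Rightarrow> real) \<Rightarrow> bool" where
  "geodetically_convex u \<longleftrightarrow>
     (\<forall>p q a b \<Gamma>. heis_geodesic a b \<Gamma> p q \<and> constant_speed a b \<Gamma> \<longrightarrow>
        convex_on {a..b} (u \<circ> \<Gamma>))"

end

theory Submission
  imports Defs
begin

text \<open>
  The helices of the Heisenberg group are the reason why only constants are geodetically convex.
  Every short piece of the horizontal lift of a circle, of whatever radius \<open>r\<close>, is a geodesic
  parametrised by arc length. So a geodetically convex function \<open>u\<close> is locally convex, and hence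
  convex, along the whole infinite helix. A small helix climbs very slowly: it gains a height of
  order \<open>r\<^sup>2\<close> per turn and stays within a bounded region during about \<open>1 / r\<^sup>2\<close> turns. There the
  continuous function \<open>u\<close> is bounded, and a convex function that stays bounded over a window of
  \<open>1 / r\<^sup>2\<close> turns in both directions changes only by \<open>O(r\<^sup>2)\<close> within a fixed part of a turn. On the
  other hand this part of a turn covers a horizontal distance of order \<open>r\<close>. Alternating between
  helices of opposite orientation, whose heights cancel, one travels along a horizontal line in
  \<open>O(1 / r)\<close> steps, so that \<open>u\<close> changes by \<open>O(r)\<close> in total, for every \<open>r > 0\<close>. Hence \<open>u\<close> is
  constant on horizontal lines (\<open>constant_along_X\<close>, \<open>constant_along_Y\<close>), and these connect all
  points. (For a smooth function the same phenomenon is seen infinitesimally: the second derivative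
  along a horizontal curve of curvature \<open>\<kappa>\<close> contains a term \<open>\<kappa>\<close> times a horizontal derivative, which
  must vanish when the sum is nonnegative for all \<open>\<kappa>\<close>.)

  That arcs of helices minimise length among all absolutely continuous horizontal curves is proved
  by a calibration (\<open>heis_arc_geodesic\<close>): a function whose derivative along horizontal vectors is
  at most the horizontal norm, with equality along the arc. Only arcs that span the angle \<open>1\<close> are
  needed, and competitors that are shorter than such an arc cannot leave the region where the
  calibration is smooth. The analytic ingredient is the fundamental theorem of calculus for
  absolutely continuous curves that are differentiable off a null set
  (\<open>fundamental_theorem_of_calculus_abs_continuous\<close>). Translations, dilations, rotations and a
  reflection reduce all helices to one of radius one.
\<close>

section \<open>Absolutely continuous curves\<close>

lemma division_of_real_interval:
  fixes d :: "real set set"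
  assumes "d division_of S" "K \<in> d"
  obtains u v where "u \<le> v" "K = {u..v}" "Inf K = u" "Sup K = v" "u \<in> S" "v \<in> S"
proof -
  obtain u v where K: "K = cbox u v" "K \<noteq> {}"
    using assms by (metis division_ofD(3,4))
  with assms have "u \<le> v" "K \<subseteq> S"
    by (auto dest: division_ofD(2))
  with K show thesis
    by (intro that[of u v]) auto
qed

lemma sum_division_lengths_le_measure:
  fixes d :: "real set set"
  assumes d: "d division_of S" and "S \<subseteq> U" "U \<in> lmeasurable"
  shows "(\<Sum>K\<in>d. Sup K - Inf K) \<le> measure lebesgue U"
proof -
  have "(\<Sum>K\<in>d. Sup K - Inf K) = (\<Sum>K\<in>d. measure lebesgue K)"
    by (rule sum.cong) (auto elim!: division_of_real_interval[OF d])
  also have "\<dots> = measure lebesgue (\<Union>d)"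
  proof (rule measure_negligible_finite_Union[symmetric])
    show "finite d"
      using d by auto
    show "K \<in> lmeasurable" if "K \<in> d" for K
      using division_of_real_interval[OF d that] by (metis lmeasurable_interval(1) box_real(2) lmeasurable_cbox)
    show "pairwise (\<lambda>S T. negligible (S \<inter> T)) d"
    proof (rule pairwiseI)
      fix K L assume KL: "K \<in> d" "L \<in> d" "K \<noteq> L"
      then have "interior K \<inter> interior L = {}"
        using d by (meson division_ofD(5))
      then have "interior (K \<inter> L) = {}"
        by simp
      moreover have "convex (K \<inter> L)"
        using KL by (auto elim!: division_of_real_interval[OF d] intro!: convex_Int)
      ultimately show "negligible (K \<inter> L)"
        using negligible_convex_interior by blast
    qed
  qed
  also have "\<dots> \<le> measure lebesgue U"
  proof (rule measure_mono_fmeasurable)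
    show "\<Union>d \<subseteq> U" using d assms by auto
    have "K \<in> sets lebesgue" if "K \<in> d" for K
      using that by (auto elim!: division_of_real_interval[OF d])
    then show "\<Union>d \<in> sets lebesgue"
      using d by (intro sets.finite_Union) auto
  qed (use assms in auto)
  finally show ?thesis .
qed

lemma abs_continuous_on_subinterval:
  assumes "abs_continuous_on a b f" "{c..e} \<subseteq> {a..b}"
  shows "abs_continuous_on c e f"
  using assms unfolding abs_continuous_on_def by (meson order_trans)

lemma abs_continuous_on_lipschitz_compose:
  assumes f: "abs_continuous_on a b f" and "K \<ge> 0"
    and lip: "\<And>s t. s \<in> {a..b} \<Longrightarrow> t \<in> {a..b} \<Longrightarrow> norm (g s - g t) \<le> K * norm (f s - f t)"
  shows "abs_continuous_on a b g"
  unfolding abs_continuous_on_def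
proof (intro allI impI)
  fix e :: real assume "e > 0"
  then have "e / (K + 1) > 0"
    using \<open>K \<ge> 0\<close> by simp
  then obtain \<delta> where \<delta>: "\<delta> > 0"
    "\<And>d. d division_of (\<Union>d) \<and> \<Union>d \<subseteq> {a..b} \<and> (\<Sum>k\<in>d. Sup k - Inf k) < \<delta> \<Longrightarrow>
        (\<Sum>k\<in>d. norm (f (Sup k) - f (Inf k))) < e / (K + 1)"
    using f unfolding abs_continuous_on_def by meson
  have "(\<Sum>k\<in>d. norm (g (Sup k) - g (Inf k))) < e"
    if d: "d division_of (\<Union>d)" "\<Union>d \<subseteq> {a..b}" "(\<Sum>k\<in>d. Sup k - Inf k) < \<delta>" for d
  proof -
    have "(\<Sum>k\<in>d. norm (g (Sup k) - g (Inf k))) \<le> (\<Sum>k\<in>d. K * norm (f (Sup k) - f (Inf k)))"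
    proof (rule sum_mono)
      fix k assume "k \<in> d"
      with d show "norm (g (Sup k) - g (Inf k)) \<le> K * norm (f (Sup k) - f (Inf k))"
        by (metis division_of_real_interval lip subsetD)
    qed
    also have "\<dots> \<le> (K + 1) * (\<Sum>k\<in>d. norm (f (Sup k) - f (Inf k)))"
      by (simp add: sum_distrib_left distrib_right sum.distrib sum_nonneg)
    also have "\<dots> < (K + 1) * (e / (K + 1))"
      using \<delta>(2) d \<open>K \<ge> 0\<close> by (intro mult_strict_left_mono) auto
    finally show ?thesis
      using \<open>K \<ge> 0\<close> by simp
  qed
  with \<delta>(1) show "\<exists>\<delta>>0. \<forall>d. d division_of (\<Union>d) \<and> \<Union>d \<subseteq> {a..b} \<and> (\<Sum>k\<in>d. Sup k - Inf k) < \<delta> \<longrightarrow>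
        (\<Sum>k\<in>d. norm (g (Sup k) - g (Inf k))) < e"
    by blast
qed

lemma abs_continuous_on_lipschitz:
  assumes "K \<ge> 0"
    and lip: "\<And>s t. s \<in> {a..b} \<Longrightarrow> t \<in> {a..b} \<Longrightarrow> norm (g s - g t) \<le> K * \<bar>s - t\<bar>"
  shows "abs_continuous_on a b g"
proof (rule abs_continuous_on_lipschitz_compose)
  show "abs_continuous_on a b (\<lambda>s. s)"
    unfolding abs_continuous_on_def
  proof (intro allI impI)
    fix e :: real assume "e > 0"
    have "(\<Sum>k\<in>d. norm (Sup k - Inf k)) = (\<Sum>k\<in>d. Sup k - Inf k)"
      if "d division_of (\<Union>d)" for d :: "real set set"
      by (rule sum.cong) (use that in \<open>auto elim!: division_of_real_interval\<close>)
    with \<open>e > 0\<close> show "\<exists>\<delta>>0. \<forall>d. d division_of (\<Union>d) \<and> \<Union>d \<subseteq> {a..b} \<and>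
        (\<Sum>k\<in>d. Sup k - Inf k) < \<delta> \<longrightarrow> (\<Sum>k\<in>d. norm (Sup k - Inf k)) < e"
      by (metis (no_types, lifting))
  qed
qed (use assms in auto)

text \<open>A null exceptional set is harmless because it can be covered by an open set of small
  measure: the intervals of a fine tagged division whose tag is exceptional then have small total
  length, and absolute continuity bounds the increments of \<open>f\<close> over them. The remaining intervals
  are treated as in the classical theorem.\<close>

lemma fundamental_theorem_of_calculus_abs_continuous:
  fixes f :: "real \<Rightarrow> 'a::banach"
  assumes "a \<le> b" and ac: "abs_continuous_on a b f" and N: "negligible N"
    and deriv: "\<And>x. x \<in> {a..b} - N \<Longrightarrow> (f has_vector_derivative f' x) (at x within {a..b})"
  shows "(f' has_integral (f b - f a)) {a..b}"
proof -
  define g where "g x = (if x \<in> N then 0 else f' x)" for x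
  have "(g has_integral (f b - f a)) {a..b}"
    unfolding has_integral_real
  proof (intro allI impI)
    fix e :: real assume "e > 0"
    define e' where "e' = e / (2 * (b - a + 1))"
    have "e' > 0"
      using \<open>e > 0\<close> \<open>a \<le> b\<close> by (simp add: e'_def)
    obtain \<delta> where "\<delta> > 0" and \<delta>:
      "\<And>d. d division_of (\<Union>d) \<and> \<Union>d \<subseteq> {a..b} \<and> (\<Sum>k\<in>d. Sup k - Inf k) < \<delta> \<Longrightarrow>
          (\<Sum>k\<in>d. norm (f (Sup k) - f (Inf k))) < e / 2"
      using ac \<open>e > 0\<close> unfolding abs_continuous_on_def by (meson half_gt_zero)
    have Nnull: "N \<in> null_sets lebesgue"
      using N by (simp add: negligible_iff_null_sets)
    obtain U where U: "open U" "N \<subseteq> U" "(U - N) \<in> lmeasurable" "emeasure lebesgue (U - N) < ennreal \<delta>"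
      using sets_lebesgue_outer_open[of N \<delta>] Nnull \<open>\<delta> > 0\<close> by blast
    have Ueq: "U = (U - N) \<union> N"
      using U by auto
    have Um: "U \<in> lmeasurable"
      using U(3) N Ueq by (metis fmeasurable.Un negligible_imp_measurable)
    have "emeasure lebesgue U < ennreal \<delta>"
      using U(4) Nnull Ueq U(3) by (metis emeasure_Un_null_set fmeasurableD)
    with Um have Ud: "measure lebesgue U < \<delta>"
      by (metis emeasure_eq_measure2 ennreal_less_iff measure_nonneg)
    have "\<exists>d>0. x \<in> {a..b} - N \<longrightarrow>
         (\<forall>y\<in>{a..b}. norm (y-x) < d \<longrightarrow> norm (f y - f x - (y-x) *\<^sub>R g x) \<le> e' * norm (y-x))" for x
    proof (cases "x \<in> {a..b} - N")
      case True
      then have "g x = f' x"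
        by (simp add: g_def)
      with deriv[OF True] \<open>e' > 0\<close> show ?thesis
        unfolding has_vector_derivative_def has_derivative_within_alt by auto
    qed (auto intro: exI[of _ 1])
    then obtain d where d: "\<And>x. 0 < d x"
        "\<And>x y. \<lbrakk>x \<in> {a..b} - N; y \<in> {a..b}; norm (y-x) < d x\<rbrakk>
                        \<Longrightarrow> norm (f y - f x - (y-x) *\<^sub>R g x) \<le> e' * norm (y-x)"
      by metis
    define \<gamma> where "\<gamma> x = (if x \<in> N then U else ball x (d x))" for x
    have "gauge \<gamma>"
      using U d(1) by (auto simp: gauge_def \<gamma>_def)
    moreover have "norm ((\<Sum>(x,k)\<in>p. measure lborel k *\<^sub>R g x) - (f b - f a)) < e"
      if p: "p tagged_division_of {a..b}" and fine: "\<gamma> fine p" for p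
    proof -
      have pc: "p tagged_division_of cbox a b"
        using p by simp
      have finp: "finite p"
        using p by blast
      define D where "D = (\<lambda>(x, K). measure lborel K *\<^sub>R g x - (f (Sup K) - f (Inf K)))"
      define p1 where "p1 = {xk \<in> p. fst xk \<in> N}"
      define p2 where "p2 = {xk \<in> p. fst xk \<notin> N}"
      have p12: "p = p1 \<union> p2" "p1 \<inter> p2 = {}" "p1 \<subseteq> p" "p2 \<subseteq> p"
        by (auto simp: p1_def p2_def)
      have tel: "b - a = (\<Sum>(x,K)\<in>p. Sup K - Inf K)" "f b - f a = (\<Sum>(x,K)\<in>p. f(Sup K) - f(Inf K))"
        using additive_tagged_division_1[where f= "\<lambda>x. x"] additive_tagged_division_1[where f= f]
            \<open>a \<le> b\<close> p by auto
      have seg: "\<exists>u v. K = {u..v} \<and> u \<le> x \<and> x \<le> v \<and> a \<le> u \<and> v \<le> b \<and> Inf K = u \<and> Sup K = v"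
        if xK: "(x, K) \<in> p" for x K
      proof -
        have "x \<in> K" and kab: "K \<subseteq> {a..b}"
          using p xK by blast+
        obtain u v where k: "K = cbox u v"
          using tagged_division_ofD(4)[OF pc xK] by blast
        show ?thesis
          using \<open>x \<in> K\<close> kab k by (intro exI[of _ u] exI[of _ v]) auto
      qed
      \<comment> \<open>Tags off \<open>N\<close>: the difference quotients are close to the derivative.\<close>
      have "norm (sum D p2) \<le> (\<Sum>(x,K)\<in>p2. e' * (Sup K - Inf K))"
      proof (rule sum_norm_le, safe)
        fix x K assume xK: "(x, K) \<in> p2"
        then obtain u v where uv: "K = {u..v}" "u \<le> x" "x \<le> v" "a \<le> u" "v \<le> b" "Inf K = u" "Sup K = v"
          using seg p12 by blast
        have xN: "x \<in> {a..b} - N"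
          using xK uv by (auto simp: p2_def)
        have "(x, K) \<in> p"
          using xK by (simp add: p2_def)
        then have "K \<subseteq> \<gamma> x"
          using fine by (rule fineD[rotated])
        then have KB: "K \<subseteq> ball x (d x)"
          using xN by (simp add: \<gamma>_def)
        have "u \<in> K" "v \<in> K"
          using uv by auto
        then have "u \<in> ball x (d x)" "v \<in> ball x (d x)"
          using KB by blast+
        then have "norm (f u - f x - (u-x) *\<^sub>R g x) \<le> e' * norm (u-x)"
             "norm (f v - f x - (v-x) *\<^sub>R g x) \<le> e' * norm (v-x)"
          using d(2)[OF xN, of u] d(2)[OF xN, of v] uv by (simp_all add: dist_real_def)
        moreover have "D (x, K) = (f u - f x - (u-x) *\<^sub>R g x) - (f v - f x - (v-x) *\<^sub>R g x)"
          using uv by (simp add: D_def algebra_simps)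
        ultimately have "norm (D (x,K)) \<le> e' * norm (u-x) + e' * norm (v-x)"
          by (metis (no_types, lifting) add_mono norm_triangle_ineq4 order_trans)
        also have "\<dots> = e' * (Sup K - Inf K)"
          using uv by (simp add: algebra_simps)
        finally show "norm (D (x,K)) \<le> e' * (Sup K - Inf K)" .
      qed
      also have "\<dots> \<le> (\<Sum>(x,K)\<in>p. e' * (Sup K - Inf K))"
      proof (rule sum_mono2[OF finp p12(4)])
        show "0 \<le> (case xk of (x, K) \<Rightarrow> e' * (Sup K - Inf K))" if "xk \<in> p - p2" for xk
          using seg that \<open>e' > 0\<close> by (cases xk) fastforce
      qed
      also have "\<dots> = e' * (b - a)"
        unfolding tel(1) sum_distrib_left by (simp add: case_prod_unfold)
      also have "\<dots> < e / 2"
        using \<open>e > 0\<close> \<open>a \<le> b\<close> by (simp add: e'_def field_simps)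
      finally have 2: "norm (sum D p2) < e / 2" .
      \<comment> \<open>Tags in \<open>N\<close>: the intervals have small total length, so absolute continuity applies.\<close>
      have part: "p1 tagged_partial_division_of {a..b}"
        by (metis p12(3) p tagged_division_of_def tagged_partial_division_subset)
      then have div: "snd ` p1 division_of \<Union>(snd ` p1)"
        by (rule partial_division_of_tagged_division)
      have tag: "p1 tagged_division_of \<Union>(snd ` p1)"
        using part by (auto simp: tagged_partial_division_of_def tagged_division_of_def)
      have "K \<subseteq> U" if "(x, K) \<in> p1" for x K
        using fineD[OF fine, of x K] that by (simp add: p1_def \<gamma>_def)
      then have "\<Union>(snd ` p1) \<subseteq> U"
        by fastforce
      then have "(\<Sum>K\<in>snd ` p1. Sup K - Inf K) < \<delta>"
        using sum_division_lengths_le_measure[OF div _ Um] Ud by linarith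
      moreover have "\<Union>(snd ` p1) \<subseteq> {a..b}"
        using tagged_partial_division_ofD(3)[OF part] by fastforce
      ultimately have "(\<Sum>K\<in>snd ` p1. norm (f (Sup K) - f (Inf K))) < e / 2"
        using div by (intro \<delta>) simp
      moreover have "(\<Sum>(x,K)\<in>p1. norm (f (Sup K) - f (Inf K))) \<le> (\<Sum>K\<in>snd ` p1. norm (f (Sup K) - f (Inf K)))"
      proof -
        \<comment> \<open>A degenerate interval may carry several tags, but it contributes nothing.\<close>
        define h where "h K = (if measure lborel K = 0 then 0 else norm (f (Sup K) - f (Inf K)))" for K
        have "(\<Sum>(x,K)\<in>p1. norm (f (Sup K) - f (Inf K))) = (\<Sum>(x,K)\<in>p1. h K)"
        proof (rule sum.cong, simp, safe)
          fix x K assume "(x, K) \<in> p1"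
          then obtain u v where "K = {u..v}" "u \<le> v" "Inf K = u" "Sup K = v"
            using seg[of x K] p12(3) by fastforce
          then show "norm (f (Sup K) - f (Inf K)) = h K"
            by (cases "u = v") (simp_all add: h_def)
        qed
        also have "\<dots> = (\<Sum>K\<in>snd ` p1. h K)"
          by (rule sum.over_tagged_division_lemma[OF tag]) (simp add: h_def content_eq_0_interior)
        also have "\<dots> \<le> (\<Sum>K\<in>snd ` p1. norm (f (Sup K) - f (Inf K)))"
          by (rule sum_mono) (simp add: h_def)
        finally show ?thesis .
      qed
      moreover have "norm (sum D p1) \<le> (\<Sum>(x,K)\<in>p1. norm (f (Sup K) - f (Inf K)))"
        by (rule sum_norm_le) (auto simp: D_def p1_def g_def intro!: eq_refl norm_minus_commute)
      ultimately have 1: "norm (sum D p1) < e / 2"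
        by linarith
      have "(\<Sum>(x,k)\<in>p. measure lborel k *\<^sub>R g x) - (f b - f a) = sum D p"
        unfolding tel(2) D_def by (simp add: case_prod_unfold sum_subtractf)
      also have "\<dots> = sum D p1 + sum D p2"
        using p12 finp by (metis finite_subset sum.union_disjoint)
      finally show ?thesis
        using 1 2 norm_triangle_ineq[of "sum D p1" "sum D p2"] by simp
    qed
    ultimately show "\<exists>\<gamma>. gauge \<gamma> \<and> (\<forall>p. p tagged_division_of {a..b} \<and> \<gamma> fine p \<longrightarrow>
        norm ((\<Sum>(x,k)\<in>p. measure lborel k *\<^sub>R g x) - (f b - f a)) < e)"
      by (intro exI[of _ \<gamma>] conjI allI impI) simp_all
  qed
  then show ?thesis
    using has_integral_spike[where f=g and g=f' and T="{a..b}", OF N] by (simp add: g_def)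
qed

text \<open>The integral that defines the length of a curve has the default value \<open>0\<close> when its
  integrand is not Lebesgue integrable, so integrability of the derivative has to be established
  before any length is bounded from below. On an interval shorter than the \<open>\<delta>\<close> that belongs to
  \<open>\<epsilon> = 1\<close>, the variation of \<open>f\<close> is at most \<open>1\<close>; finitely many such intervals suffice.\<close>

lemma abs_continuous_derivative_absolutely_integrable:
  fixes f :: "real \<Rightarrow> 'a::euclidean_space"
  assumes "a \<le> b" and ac: "abs_continuous_on a b f" and N: "negligible N"
    and deriv: "\<And>x. x \<in> {a..b} - N \<Longrightarrow> (f has_vector_derivative f' x) (at x within {a..b})"
  shows "f' absolutely_integrable_on {a..b}"
proof -
  have ftc: "(f' has_integral (f v - f u)) {u..v}" if "u \<le> v" "{u..v} \<subseteq> {a..b}" for u v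
  proof (rule fundamental_theorem_of_calculus_abs_continuous[OF that(1) _ N])
    show "abs_continuous_on u v f"
      using ac that(2) by (rule abs_continuous_on_subinterval)
    show "(f has_vector_derivative f' x) (at x within {u..v})" if "x \<in> {u..v} - N" for x
      using deriv that \<open>{u..v} \<subseteq> {a..b}\<close> by (blast intro: has_vector_derivative_within_subset)
  qed
  obtain \<delta> where "\<delta> > 0" and \<delta>:
    "\<And>d. d division_of (\<Union>d) \<and> \<Union>d \<subseteq> {a..b} \<and> (\<Sum>k\<in>d. Sup k - Inf k) < \<delta> \<Longrightarrow>
        (\<Sum>k\<in>d. norm (f (Sup k) - f (Inf k))) < 1"
    using ac unfolding abs_continuous_on_def by (meson zero_less_one)
  have short: "f' absolutely_integrable_on {u..v}" if uv: "u \<le> v" "v - u < \<delta>" "{u..v} \<subseteq> {a..b}" for u v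
  proof -
    have "f' absolutely_integrable_on cbox u v"
    proof (rule bounded_variation_absolutely_integrable_interval)
      show "f' integrable_on cbox u v"
        using ftc uv by auto
      fix d assume d: "d division_of cbox u v"
      have "(\<Sum>K\<in>d. norm (integral K f')) = (\<Sum>K\<in>d. norm (f (Sup K) - f (Inf K)))"
      proof (rule sum.cong)
        fix K assume K: "K \<in> d"
        then obtain s t where st: "s \<le> t" "K = {s..t}" "Inf K = s" "Sup K = t" "s \<in> cbox u v" "t \<in> cbox u v"
          using division_of_real_interval[OF d] by metis
        then have "{s..t} \<subseteq> {a..b}"
          using uv by auto
        with st show "norm (integral K f') = norm (f (Sup K) - f (Inf K))"
          using ftc[OF st(1)] by (simp add: integral_unique)
      qed simp
      also have "\<dots> < 1"
      proof (rule \<delta>, intro conjI)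
        have [simp]: "\<Union>d = {u..v}"
          using d by (simp add: division_ofD(6))
        show "d division_of \<Union>d" "\<Union>d \<subseteq> {a..b}"
          using d uv by auto
        have "(\<Sum>K\<in>d. Sup K - Inf K) \<le> measure lebesgue (cbox u v)"
          by (rule sum_division_lengths_le_measure[OF d]) auto
        then show "(\<Sum>K\<in>d. Sup K - Inf K) < \<delta>"
          using uv by simp
      qed
      finally show "(\<Sum>K\<in>d. norm (integral K f')) \<le> 1"
        by simp
    qed
    then show ?thesis by simp
  qed
  have "{u..v} \<subseteq> {a..b} \<longrightarrow> f' absolutely_integrable_on {u..v}" if "u \<le> v" for u v
    using that
  proof (induction u v rule: Bolzano)
    case (trans u v w)
    show ?case
    proof
      assume "{u..w} \<subseteq> {a..b}"
      with trans have "f' absolutely_integrable_on {u..v}" "f' absolutely_integrable_on {v..w}"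
        by auto
      then have "f' absolutely_integrable_on ({u..v} \<union> {v..w})"
        by (rule set_integrable_Un) auto
      then show "f' absolutely_integrable_on {u..w}"
        using trans by (simp add: ivl_disj_un_two_touch)
    qed
  next
    case (local x)
    show ?case
      using \<open>\<delta> > 0\<close> short by (intro exI[of _ \<delta>]) auto
  qed
  then show ?thesis
    using \<open>a \<le> b\<close> by simp
qed

section \<open>Length of horizontal curves and calibrations\<close>

lemma heis_proj_eq: "heis_proj p = (fst p, fst (snd p))"
  by (cases p) (simp add: heis_proj_def)

lemma bounded_linear_heis_proj: "bounded_linear (heis_proj :: 'n::finite heis \<Rightarrow> _)"
  unfolding heis_proj_eq
  by (intro bounded_linear_Pair bounded_linear_fst bounded_linear_compose[OF bounded_linear_fst bounded_linear_snd])

lemma norm_heis_proj_le: "norm (heis_proj p) \<le> norm (p :: 'n::finite heis)"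
proof (cases p)
  case (fields x y t)
  have "(norm x)\<^sup>2 + (norm y)\<^sup>2 \<le> (norm x)\<^sup>2 + ((norm y)\<^sup>2 + (norm t)\<^sup>2)"
    by simp
  then show ?thesis
    by (simp add: fields heis_proj_def norm_Pair)
qed

text \<open>The strict inequalities make the interval nondegenerate, as uniqueness of the derivative
  within it requires.\<close>

lemma heis_speed_eq:
  assumes "a < s" "s < b" and "(\<Gamma> has_vector_derivative v) (at s within {a..b})"
  shows "heis_speed a b \<Gamma> s = norm (heis_proj v)"
proof -
  have "((heis_proj \<circ> \<Gamma>) has_vector_derivative heis_proj v) (at s within {a..b})"
    unfolding o_def using bounded_linear.has_vector_derivative[OF bounded_linear_heis_proj assms(3)] .
  then have "vector_derivative (heis_proj \<circ> \<Gamma>) (at s within {a..b}) = heis_proj v"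
    using assms by (intro vector_derivative_within_closed_interval) auto
  then show ?thesis
    by (simp add: heis_speed_def)
qed

lemma horizontal_curve_velocityE:
  fixes \<Gamma> :: "real \<Rightarrow> 'n::finite heis"
  assumes "horizontal_curve a b \<Gamma>"
  obtains N v where "negligible N"
    and "\<And>s. s \<in> {a..b} - N \<Longrightarrow> (\<Gamma> has_vector_derivative v s) (at s within {a..b})"
    and "\<And>s. s \<in> {a..b} - N \<Longrightarrow> v s \<in> horizontal_space (\<Gamma> s)"
    and "\<And>s. s \<in> {a..b} - N \<Longrightarrow> heis_speed a b \<Gamma> s = norm (heis_proj (v s))"
proof -
  have "AE s in lebesgue. s \<in> {a..b} \<longrightarrow>
     (\<exists>v. (\<Gamma> has_vector_derivative v) (at s within {a..b}) \<and> v \<in> horizontal_space (\<Gamma> s))"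
    using assms by (simp add: horizontal_curve_def)
  then obtain N where N: "N \<in> null_sets lebesgue"
    "{s. \<not> (s \<in> {a..b} \<longrightarrow> (\<exists>v. (\<Gamma> has_vector_derivative v) (at s within {a..b}) \<and>
        v \<in> horizontal_space (\<Gamma> s)))} \<subseteq> N"
    unfolding eventually_ae_filter by auto
  then have "\<forall>s\<in>{a..b} - N. \<exists>v. (\<Gamma> has_vector_derivative v) (at s within {a..b}) \<and>
        v \<in> horizontal_space (\<Gamma> s)"
    by blast
  then obtain v where v: "\<And>s. s \<in> {a..b} - N \<Longrightarrow> (\<Gamma> has_vector_derivative v s) (at s within {a..b})"
    "\<And>s. s \<in> {a..b} - N \<Longrightarrow> v s \<in> horizontal_space (\<Gamma> s)"
    by metis
  show thesis
  proof (rule that[of "N \<union> {a, b}" v])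
    show "negligible (N \<union> {a, b})"
      using N(1) by (simp add: negligible_iff_null_sets[symmetric])
    show "heis_speed a b \<Gamma> s = norm (heis_proj (v s))" if "s \<in> {a..b} - (N \<union> {a, b})" for s
      using that v(1)[of s] by (intro heis_speed_eq) auto
  qed (use v in auto)
qed

lemma heis_proj_abs_continuous:
  fixes \<Gamma> :: "real \<Rightarrow> 'n::finite heis"
  assumes "abs_continuous_on a b \<Gamma>"
  shows "abs_continuous_on a b (\<lambda>s. heis_proj (\<Gamma> s))"
  using assms
proof (rule abs_continuous_on_lipschitz_compose[where K=1])
  show "norm (heis_proj (\<Gamma> s) - heis_proj (\<Gamma> t)) \<le> 1 * norm (\<Gamma> s - \<Gamma> t)" for s t
    using norm_heis_proj_le[of "\<Gamma> s - \<Gamma> t"] bounded_linear_heis_proj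
    by (metis bounded_linear.linear linear_diff mult_1)
qed auto

lemma heis_speed_has_integral:
  fixes \<Gamma> :: "real \<Rightarrow> 'n::finite heis"
  assumes "horizontal_curve a b \<Gamma>"
  shows "(heis_speed a b \<Gamma> has_integral heis_length a b \<Gamma>) {a..b}"
proof -
  obtain N v where N: "negligible N"
    and v: "\<And>s. s \<in> {a..b} - N \<Longrightarrow> (\<Gamma> has_vector_derivative v s) (at s within {a..b})"
    and sp: "\<And>s. s \<in> {a..b} - N \<Longrightarrow> heis_speed a b \<Gamma> s = norm (heis_proj (v s))"
    using horizontal_curve_velocityE[OF assms] by metis
  have ab: "a \<le> b" "abs_continuous_on a b \<Gamma>"
    using assms by (auto simp: horizontal_curve_def)
  have "(\<lambda>s. heis_proj (v s)) absolutely_integrable_on {a..b}"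
    using ab(1) heis_proj_abs_continuous[OF ab(2)] N
    by (rule abs_continuous_derivative_absolutely_integrable)
       (rule bounded_linear.has_vector_derivative[OF bounded_linear_heis_proj v])
  then have "(\<lambda>s. norm (heis_proj (v s))) absolutely_integrable_on {a..b}"
    by (rule absolutely_integrable_norm[unfolded o_def])
  then have "heis_speed a b \<Gamma> absolutely_integrable_on {a..b}"
    using N sp by (rule absolutely_integrable_spike)
  then show ?thesis
    unfolding heis_length_def
    using set_lebesgue_integral_eq_integral by (metis integrable_integral)
qed

text \<open>Confines a short competitor to a small cylinder, where a calibration that is only defined
  locally can be used.\<close>

lemma norm_heis_proj_diff_le_length:
  fixes \<Gamma> :: "real \<Rightarrow> 'n::finite heis"
  assumes hc: "horizontal_curve a b \<Gamma>" and r: "r \<in> {a..b}"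
  shows "norm (heis_proj (\<Gamma> r) - heis_proj (\<Gamma> a)) \<le> heis_length a b \<Gamma>"
proof -
  obtain N v where N: "negligible N"
    and v: "\<And>s. s \<in> {a..b} - N \<Longrightarrow> (\<Gamma> has_vector_derivative v s) (at s within {a..b})"
    and sp: "\<And>s. s \<in> {a..b} - N \<Longrightarrow> heis_speed a b \<Gamma> s = norm (heis_proj (v s))"
    using horizontal_curve_velocityE[OF hc] by metis
  define w where "w s = (if s \<in> N then 0 else heis_proj (v s))" for s
  have sub: "{a..r} \<subseteq> {a..b}"
    using r by auto
  have ac: "abs_continuous_on a r (\<lambda>s. heis_proj (\<Gamma> s))"
    using hc sub by (auto simp: horizontal_curve_def intro: heis_proj_abs_continuous abs_continuous_on_subinterval)
  have "(w has_integral (heis_proj (\<Gamma> r) - heis_proj (\<Gamma> a))) {a..r}"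
  proof (rule fundamental_theorem_of_calculus_abs_continuous[OF _ ac N])
    fix s assume s: "s \<in> {a..r} - N"
    then have "(\<Gamma> has_vector_derivative v s) (at s within {a..r})"
      using v[of s] sub by (auto intro: has_vector_derivative_within_subset)
    then show "((\<lambda>s. heis_proj (\<Gamma> s)) has_vector_derivative w s) (at s within {a..r})"
      using bounded_linear.has_vector_derivative[OF bounded_linear_heis_proj, of \<Gamma> "v s"] s
      by (simp add: w_def)
  qed (use r in auto)
  moreover have int: "heis_speed a b \<Gamma> integrable_on {a..b}" "heis_speed a b \<Gamma> integrable_on {a..r}"
    using heis_speed_has_integral[OF hc] sub by (auto intro: integrable_on_subinterval)
  moreover have "norm (w s) \<le> heis_speed a b \<Gamma> s" if "s \<in> {a..r}" for s
    using that sp[of s] sub by (auto simp: w_def heis_speed_def)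
  ultimately have "norm (heis_proj (\<Gamma> r) - heis_proj (\<Gamma> a)) \<le> integral {a..r} (heis_speed a b \<Gamma>)"
    by (metis (no_types, lifting) has_integral_integrable_integral integral_norm_bound_integral)
  also have "\<dots> \<le> integral {a..b} (heis_speed a b \<Gamma>)"
    using sub int by (intro integral_subset_le) (auto simp: heis_speed_def)
  also have "\<dots> = heis_length a b \<Gamma>"
    using heis_speed_has_integral[OF hc] by (rule integral_unique)
  finally show ?thesis .
qed

text \<open>The calibration principle: \<open>S\<close> grows along a horizontal curve at most at the rate at
  which length is spent. Convexity of \<open>W\<close> turns the bound \<open>B\<close> into a Lipschitz constant of \<open>S\<close>,
  so that \<open>S \<circ> \<Gamma>\<close> is absolutely continuous and its growth is the integral of its derivative.\<close>

lemma calibration_le_heis_length: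
  fixes \<Gamma> :: "real \<Rightarrow> 'n::finite heis" and S :: "'n heis \<Rightarrow> real"
  assumes hc: "horizontal_curve a b \<Gamma>" and "\<And>s. s \<in> {a..b} \<Longrightarrow> \<Gamma> s \<in> W" and "convex W"
    and S: "\<And>p. p \<in> W \<Longrightarrow> (S has_derivative S' p) (at p)"
    and B: "\<And>p. p \<in> W \<Longrightarrow> onorm (S' p) \<le> B"
    and hor: "\<And>p v. p \<in> W \<Longrightarrow> v \<in> horizontal_space p \<Longrightarrow> S' p v \<le> norm (heis_proj v)"
  shows "S (\<Gamma> b) - S (\<Gamma> a) \<le> heis_length a b \<Gamma>"
proof -
  obtain N v where N: "negligible N"
    and v: "\<And>s. s \<in> {a..b} - N \<Longrightarrow> (\<Gamma> has_vector_derivative v s) (at s within {a..b})"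
    and vh: "\<And>s. s \<in> {a..b} - N \<Longrightarrow> v s \<in> horizontal_space (\<Gamma> s)"
    and sp: "\<And>s. s \<in> {a..b} - N \<Longrightarrow> heis_speed a b \<Gamma> s = norm (heis_proj (v s))"
    using horizontal_curve_velocityE[OF hc] by metis
  have ab: "a \<le> b" "abs_continuous_on a b \<Gamma>"
    using hc by (auto simp: horizontal_curve_def)
  have "B \<ge> 0"
    using B[of "\<Gamma> a"] S[of "\<Gamma> a"] assms(2)[of a] ab(1) onorm_pos_le[OF has_derivative_bounded_linear[OF S, of "\<Gamma> a"]]
    by force
  define g where "g s = (if s \<in> N then 0 else S' (\<Gamma> s) (v s))" for s
  have ac: "abs_continuous_on a b (\<lambda>s. S (\<Gamma> s))"
    using ab(2) \<open>B \<ge> 0\<close>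
  proof (rule abs_continuous_on_lipschitz_compose)
    show "norm (S (\<Gamma> s) - S (\<Gamma> t)) \<le> B * norm (\<Gamma> s - \<Gamma> t)" if "s \<in> {a..b}" "t \<in> {a..b}" for s t
      using \<open>convex W\<close> has_derivative_at_withinI[OF S] B assms(2) that
      by (intro differentiable_bound[of W]) auto
  qed
  have "(g has_integral (S (\<Gamma> b) - S (\<Gamma> a))) {a..b}"
  proof (rule fundamental_theorem_of_calculus_abs_continuous[OF ab(1) ac N])
    fix s assume s: "s \<in> {a..b} - N"
    then have "((S \<circ> \<Gamma>) has_derivative (S' (\<Gamma> s) \<circ> (\<lambda>h. h *\<^sub>R v s))) (at s within {a..b})"
      using v[OF s] S[of "\<Gamma> s"] assms(2)[of s]
      by (intro diff_chain_within) (auto simp: has_vector_derivative_def intro: has_derivative_at_withinI)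
    moreover have "S' (\<Gamma> s) \<circ> (\<lambda>h. h *\<^sub>R v s) = (\<lambda>h. h *\<^sub>R g s)"
      using s has_derivative_linear[OF S, of "\<Gamma> s"] assms(2)[of s]
      by (auto simp: g_def fun_eq_iff linear_cmul)
    ultimately show "((\<lambda>s. S (\<Gamma> s)) has_vector_derivative g s) (at s within {a..b})"
      by (simp add: has_vector_derivative_def o_def)
  qed
  moreover have "g s \<le> heis_speed a b \<Gamma> s" if "s \<in> {a..b}" for s
    using that sp[of s] hor[of "\<Gamma> s" "v s"] vh[of s] assms(2)[of s] by (auto simp: g_def heis_speed_def)
  ultimately show ?thesis
    using has_integral_le[OF _ heis_speed_has_integral[OF hc]] by blast
qed

section \<open>Similarities of the Heisenberg group\<close>

text \<open>Affine maps suffice, since left translations are affine in the coordinates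
  \<open>(x, y, t)\<close> although they are not translations of the vector space.\<close>

definition heis_similarity :: "real \<Rightarrow> ('n::finite heis \<Rightarrow> 'n heis) \<Rightarrow> bool" where
  "heis_similarity k A \<longleftrightarrow> (\<exists>L. bounded_linear L \<and> (\<forall>p q. A q = A p + L (q - p)) \<and>
     (\<forall>p. \<forall>v\<in>horizontal_space p. L v \<in> horizontal_space (A p) \<and>
        norm (heis_proj (L v)) = k * norm (heis_proj v)))"

lemma heis_similarity_curve:
  fixes \<Gamma> :: "real \<Rightarrow> 'n::finite heis"
  assumes A: "heis_similarity k A" and hc: "horizontal_curve a b \<Gamma>"
  shows "horizontal_curve a b (A \<circ> \<Gamma>)"
    and "heis_length a b (A \<circ> \<Gamma>) = k * heis_length a b \<Gamma>"
    and "AE s\<in>{a..b} in lebesgue. heis_speed a b (A \<circ> \<Gamma>) s = k * heis_speed a b \<Gamma> s"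
proof -
  obtain L where L: "bounded_linear L" "\<And>p q. A q = A p + L (q - p)"
    "\<And>p v. v \<in> horizontal_space p \<Longrightarrow> L v \<in> horizontal_space (A p)"
    "\<And>p v. v \<in> horizontal_space p \<Longrightarrow> norm (heis_proj (L v)) = k * norm (heis_proj v)"
    using A unfolding heis_similarity_def by blast
  obtain N v where N: "negligible N"
    and v: "\<And>s. s \<in> {a..b} - N \<Longrightarrow> (\<Gamma> has_vector_derivative v s) (at s within {a..b})"
    and vh: "\<And>s. s \<in> {a..b} - N \<Longrightarrow> v s \<in> horizontal_space (\<Gamma> s)"
    and sp: "\<And>s. s \<in> {a..b} - N \<Longrightarrow> heis_speed a b \<Gamma> s = norm (heis_proj (v s))"
    using horizontal_curve_velocityE[OF hc] by metis
  have ab: "a \<le> b" "abs_continuous_on a b \<Gamma>"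
    using hc by (auto simp: horizontal_curve_def)
  have AL: "A p = A 0 + L p" for p
    using L(2)[of p 0] by simp
  have ac: "abs_continuous_on a b (A \<circ> \<Gamma>)"
    using ab(2) onorm_pos_le[OF L(1)]
  proof (rule abs_continuous_on_lipschitz_compose)
    show "norm ((A \<circ> \<Gamma>) s - (A \<circ> \<Gamma>) t) \<le> onorm L * norm (\<Gamma> s - \<Gamma> t)" for s t
      using onorm[OF L(1), of "\<Gamma> s - \<Gamma> t"] L(2)[of "\<Gamma> s" "\<Gamma> t"] by simp
  qed
  have dA: "((A \<circ> \<Gamma>) has_vector_derivative L (v s)) (at s within {a..b})" if "s \<in> {a..b} - N" for s
  proof -
    have "((\<lambda>s. A 0 + L (\<Gamma> s)) has_vector_derivative 0 + L (v s)) (at s within {a..b})"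
      using bounded_linear.has_vector_derivative[OF L(1) v[OF that]]
      by (intro has_vector_derivative_add has_vector_derivative_const)
    then show ?thesis
      by (simp add: o_def AL[symmetric])
  qed
  have N': "negligible (N \<union> {a, b})"
    using N by simp
  then have ae: "AE s in lebesgue. s \<notin> N \<union> {a, b}"
    using AE_not_in negligible_iff_null_sets by blast
  have speed: "heis_speed a b (A \<circ> \<Gamma>) s = k * heis_speed a b \<Gamma> s" if "s \<in> {a..b} - (N \<union> {a, b})" for s
  proof -
    have "heis_speed a b (A \<circ> \<Gamma>) s = norm (heis_proj (L (v s)))"
      using that dA[of s] by (intro heis_speed_eq) auto
    then show ?thesis
      using that sp[of s] vh[of s] L(4) by auto
  qed
  show hA: "horizontal_curve a b (A \<circ> \<Gamma>)"
    unfolding horizontal_curve_def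
  proof (intro conjI ab(1) ac)
    show "AE s\<in>{a..b} in lebesgue. \<exists>v. ((A \<circ> \<Gamma>) has_vector_derivative v) (at s within {a..b}) \<and>
        v \<in> horizontal_space ((A \<circ> \<Gamma>) s)"
      using ae
    proof (rule eventually_mono, intro impI)
      fix s assume "s \<notin> N \<union> {a, b}" "s \<in> {a..b}"
      then show "\<exists>v. ((A \<circ> \<Gamma>) has_vector_derivative v) (at s within {a..b}) \<and> v \<in> horizontal_space ((A \<circ> \<Gamma>) s)"
        using dA[of s] L(3)[OF vh[of s]] by (intro exI[of _ "L (v s)"]) simp
    qed
  qed
  show "AE s\<in>{a..b} in lebesgue. heis_speed a b (A \<circ> \<Gamma>) s = k * heis_speed a b \<Gamma> s"
    using ae by (rule eventually_mono) (use speed in auto)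
  have "(heis_speed a b (A \<circ> \<Gamma>) has_integral k * heis_length a b \<Gamma>) {a..b}"
    using has_integral_spike[OF N' speed has_integral_mult_right[OF heis_speed_has_integral[OF hc]]] .
  then show "heis_length a b (A \<circ> \<Gamma>) = k * heis_length a b \<Gamma>"
    using heis_speed_has_integral[OF hA] by (rule has_integral_unique[symmetric])
qed

text \<open>The inverse map pulls competitors back, so similarities preserve geodesics.\<close>

lemma geodetically_convex_similarity:
  fixes u :: "'n::finite heis \<Rightarrow> real"
  assumes u: "geodetically_convex u" and "k > 0"
    and A: "heis_similarity k A" and B: "heis_similarity (1 / k) B"
    and BA: "\<And>p. B (A p) = p"
  shows "geodetically_convex (u \<circ> A)"
  unfolding geodetically_convex_def
proof (intro allI impI, elim conjE)
  fix p q a b and \<Gamma> :: "real \<Rightarrow> 'n heis"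
  assume geo: "heis_geodesic a b \<Gamma> p q" and cs: "constant_speed a b \<Gamma>"
  then have hc: "horizontal_curve a b \<Gamma>" "\<Gamma> a = p" "\<Gamma> b = q"
    and le: "\<And>c d \<Delta>. horizontal_curve c d \<Delta> \<Longrightarrow> \<Delta> c = p \<Longrightarrow> \<Delta> d = q \<Longrightarrow>
        heis_length a b \<Gamma> \<le> heis_length c d \<Delta>"
    by (auto simp: heis_geodesic_def)
  have "heis_geodesic a b (A \<circ> \<Gamma>) (A p) (A q)"
    unfolding heis_geodesic_def
  proof (intro conjI allI impI; (elim conjE)?)
    show "horizontal_curve a b (A \<circ> \<Gamma>)" "(A \<circ> \<Gamma>) a = A p" "(A \<circ> \<Gamma>) b = A q"
      using heis_similarity_curve(1)[OF A hc(1)] hc by auto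
    fix c d and \<Delta> :: "real \<Rightarrow> 'n heis"
    assume \<Delta>: "horizontal_curve c d \<Delta>" "\<Delta> c = A p" "\<Delta> d = A q"
    then have "heis_length a b \<Gamma> \<le> heis_length c d (B \<circ> \<Delta>)"
      using heis_similarity_curve(1)[OF B \<Delta>(1)] by (intro le) (auto simp: BA)
    then show "heis_length a b (A \<circ> \<Gamma>) \<le> heis_length c d \<Delta>"
      using \<open>k > 0\<close>
      by (simp add: heis_similarity_curve(2)[OF A hc(1)] heis_similarity_curve(2)[OF B \<Delta>(1)] field_simps)
  qed
  moreover have "constant_speed a b (A \<circ> \<Gamma>)"
  proof -
    obtain c where "AE s\<in>{a..b} in lebesgue. heis_speed a b \<Gamma> s = c"
      using cs by (auto simp: constant_speed_def)
    then have "AE s\<in>{a..b} in lebesgue. heis_speed a b (A \<circ> \<Gamma>) s = k * c"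
      using heis_similarity_curve(3)[OF A hc(1)] by eventually_elim auto
    then show ?thesis
      by (auto simp: constant_speed_def)
  qed
  ultimately have "convex_on {a..b} (u \<circ> (A \<circ> \<Gamma>))"
    using u unfolding geodetically_convex_def by blast
  then show "convex_on {a..b} (u \<circ> A \<circ> \<Gamma>)"
    by (simp add: comp_assoc)
qed

lemma heis_mult_inner:
  "heis_mult (x, y, t) (x', y', t') = (x + x', y + y', t + t' + 2 * (x' \<bullet> y - x \<bullet> y'))"
  by (simp add: heis_mult_def inner_vec_def sum_subtractf)

lemma horizontal_space_inner:
  "(v, w, \<tau>) \<in> horizontal_space (x, y, t) \<longleftrightarrow> \<tau> = 2 * (v \<bullet> y - w \<bullet> x)"
  by (simp add: horizontal_space_iff inner_vec_def sum_subtractf)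

text \<open>Rotations act by the same angle in every coordinate plane, which preserves the form
  \<open>v \<bullet> y - w \<bullet> x\<close>; the reflection reverses the sign of that form and therefore also reverses
  \<open>t\<close>.\<close>

definition heis_dilation :: "real \<Rightarrow> 'n::finite heis \<Rightarrow> 'n heis" where
  "heis_dilation r = (\<lambda>(x, y, t). (r *\<^sub>R x, r *\<^sub>R y, r\<^sup>2 * t))"

definition heis_rotation :: "real \<Rightarrow> 'n::finite heis \<Rightarrow> 'n heis" where
  "heis_rotation \<theta> = (\<lambda>(x, y, t). (cos \<theta> *\<^sub>R x - sin \<theta> *\<^sub>R y, sin \<theta> *\<^sub>R x + cos \<theta> *\<^sub>R y, t))"

definition heis_reflection :: "'n::finite heis \<Rightarrow> 'n heis" where
  "heis_reflection = (\<lambda>(x, y, t). (- x, y, - t))"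

lemma heis_similarityI:
  fixes L :: "'n::finite heis \<Rightarrow> 'n heis"
  assumes "linear L" "\<And>p q. A q = A p + L (q - p)"
    and "\<And>x y t v w. L (v, w, 2 * (v \<bullet> y - w \<bullet> x)) \<in> horizontal_space (A (x, y, t))"
    and "\<And>v w \<tau>. norm (heis_proj (L (v, w, \<tau>))) = k * norm (v, w)"
  shows "heis_similarity k A"
  unfolding heis_similarity_def
proof (intro exI[of _ L] conjI allI ballI)
  show "bounded_linear L"
    using assms(1) by (simp add: linear_conv_bounded_linear)
  show "L v \<in> horizontal_space (A p)" if "v \<in> horizontal_space p" for p v
    using that assms(3) by (cases p, cases v) (auto simp: horizontal_space_inner)
  show "norm (heis_proj (L v)) = k * norm (heis_proj v)" for v
    using assms(4)[of "fst v" "fst (snd v)" "snd (snd v)"] by (simp add: heis_proj_eq)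
qed (use assms(2) in blast)

lemma heis_similarity_translation: "heis_similarity 1 (heis_mult p)"
proof (cases p)
  case (fields x y t)
  show ?thesis
  proof (rule heis_similarityI[where L="\<lambda>(v, w, \<tau>). (v, w, \<tau> + 2 * (v \<bullet> y - x \<bullet> w))"])
    show "linear (\<lambda>(v, w, \<tau>). (v, w, \<tau> + 2 * (v \<bullet> y - x \<bullet> w)))"
      by (rule linearI) (auto simp: inner_add_left inner_add_right algebra_simps)
    show "heis_mult p r = heis_mult p q + (case r - q of (v, w, \<tau>) \<Rightarrow> (v, w, \<tau> + 2 * (v \<bullet> y - x \<bullet> w)))" for q r
      by (cases q, cases r) (simp add: fields heis_mult_inner inner_diff_left inner_diff_right)
    show "(case (v, w, 2 * (v \<bullet> y' - w \<bullet> x')) of (v, w, \<tau>) \<Rightarrow> (v, w, \<tau> + 2 * (v \<bullet> y - x \<bullet> w)))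
        \<in> horizontal_space (heis_mult p (x', y', t'))" for x' y' t' v w
      by (simp add: fields heis_mult_inner horizontal_space_inner inner_add_right inner_commute[of x])
  qed (simp add: heis_proj_def)
qed

lemma heis_similarity_dilation:
  assumes "r > 0"
  shows "heis_similarity r (heis_dilation r)"
proof (rule heis_similarityI[where L="heis_dilation r"])
  show "linear (heis_dilation r :: 'a heis \<Rightarrow> _)"
    by (auto simp: heis_dilation_def algebra_simps intro!: linearI)
  show "heis_dilation r q = heis_dilation r p + heis_dilation r (q - p)" for p q :: "'a heis"
    by (cases p, cases q) (simp add: heis_dilation_def algebra_simps)
  fix x y v w :: "real ^ 'a" and t \<tau> :: real
  show "heis_dilation r (v, w, 2 * (v \<bullet> y - w \<bullet> x)) \<in> horizontal_space (heis_dilation r (x, y, t))"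
    by (simp add: heis_dilation_def horizontal_space_inner power2_eq_square algebra_simps)
  show "norm (heis_proj (heis_dilation r (v, w, \<tau>))) = r * norm (v, w)"
    using assms norm_scaleR[of r "(v, w)"] by (simp add: heis_dilation_def heis_proj_def del: norm_scaleR)
qed

lemma sin_cos_combine: "cos \<theta> * (cos \<theta> * a) + sin \<theta> * (sin \<theta> * a) = (a::real)"
  using sin_cos_squared_add3[of \<theta>] by (metis distrib_right mult.assoc mult_1)

lemma norm_rotation:
  fixes x y :: "'a::real_inner"
  shows "norm (cos \<theta> *\<^sub>R x - sin \<theta> *\<^sub>R y, sin \<theta> *\<^sub>R x + cos \<theta> *\<^sub>R y) = norm (x, y)"
proof -
  have "(norm (cos \<theta> *\<^sub>R x - sin \<theta> *\<^sub>R y))\<^sup>2 + (norm (sin \<theta> *\<^sub>R x + cos \<theta> *\<^sub>R y))\<^sup>2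
      = ((sin \<theta>)\<^sup>2 + (cos \<theta>)\<^sup>2) * ((norm x)\<^sup>2 + (norm y)\<^sup>2)"
    unfolding power2_norm_eq_inner
    using sin_cos_combine[of \<theta> "x \<bullet> x"] sin_cos_combine[of \<theta> "y \<bullet> y"]
    by (simp add: inner_add_left inner_add_right inner_diff_left inner_diff_right
        inner_commute power2_eq_square algebra_simps)
  then show ?thesis
    by (simp add: norm_Pair)
qed

lemma heis_similarity_rotation: "heis_similarity 1 (heis_rotation \<theta>)"
proof (rule heis_similarityI[where L="heis_rotation \<theta>"])
  show "linear (heis_rotation \<theta> :: 'a heis \<Rightarrow> _)"
    by (auto simp: heis_rotation_def algebra_simps intro!: linearI)
  show "heis_rotation \<theta> q = heis_rotation \<theta> p + heis_rotation \<theta> (q - p)" for p q :: "'a heis"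
    by (cases p, cases q) (simp add: heis_rotation_def algebra_simps)
  fix x y v w :: "real ^ 'a" and t \<tau> :: real
  have "v \<bullet> y - w \<bullet> x = ((sin \<theta>)\<^sup>2 + (cos \<theta>)\<^sup>2) * (v \<bullet> y - w \<bullet> x)"
    by simp
  also have "\<dots> = (cos \<theta> *\<^sub>R v - sin \<theta> *\<^sub>R w) \<bullet> (sin \<theta> *\<^sub>R x + cos \<theta> *\<^sub>R y)
      - (sin \<theta> *\<^sub>R v + cos \<theta> *\<^sub>R w) \<bullet> (cos \<theta> *\<^sub>R x - sin \<theta> *\<^sub>R y)"
    using sin_cos_combine[of \<theta> "v \<bullet> y"] sin_cos_combine[of \<theta> "w \<bullet> x"]
    by (simp add: inner_add_left inner_add_right inner_diff_left inner_diff_right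
        power2_eq_square algebra_simps)
  finally show "heis_rotation \<theta> (v, w, 2 * (v \<bullet> y - w \<bullet> x)) \<in> horizontal_space (heis_rotation \<theta> (x, y, t))"
    by (simp add: heis_rotation_def horizontal_space_inner)
  show "norm (heis_proj (heis_rotation \<theta> (v, w, \<tau>))) = 1 * norm (v, w)"
    by (simp add: heis_rotation_def heis_proj_def norm_rotation)
qed

lemma heis_similarity_reflection: "heis_similarity 1 heis_reflection"
  by (rule heis_similarityI[where L=heis_reflection])
    (auto simp: heis_reflection_def horizontal_space_inner heis_proj_def norm_Pair intro!: linearI)

lemma heis_mult_cancel: "heis_mult (- p) (heis_mult p q) = q"
  by (cases p, cases q) (simp add: heis_mult_inner inner_simps inner_commute)

lemma heis_rotation_cancel: "heis_rotation (- \<theta>) (heis_rotation \<theta> p) = p"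
proof (cases p)
  case (fields x y t)
  have "(cos \<theta> * cos \<theta> + sin \<theta> * sin \<theta>) *\<^sub>R z = z" for z :: "real ^ 'a"
    using sin_cos_squared_add3[of \<theta>] by simp
  then show ?thesis
    by (simp add: fields heis_rotation_def algebra_simps flip: scaleR_add_left)
qed

text \<open>This class of functions is invariant under composition with translations, dilations,
  rotations and the reflection, so that everything known about one helix holds for all of them.\<close>

definition continuous_geodetically_convex :: "('n::finite heis \<Rightarrow> real) \<Rightarrow> bool" where
  "continuous_geodetically_convex u \<longleftrightarrow> continuous_on UNIV u \<and> geodetically_convex u"

lemma continuous_geodetically_convex_similarity:
  assumes u: "continuous_geodetically_convex u" and "k > 0"
    and A: "heis_similarity k A" and B: "heis_similarity (1 / k) B"
    and BA: "\<And>p. B (A p) = p"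
  shows "continuous_geodetically_convex (u \<circ> A)"
proof -
  obtain L where L: "bounded_linear L" "\<And>p q. A q = A p + L (q - p)"
    using A unfolding heis_similarity_def by blast
  have eq: "A = (\<lambda>p. A 0 + L p)"
  proof
    show "A p = A 0 + L p" for p
      using L(2)[where p=0 and q=p] by (simp only: diff_zero)
  qed
  have "continuous_on UNIV A"
    by (subst eq) (intro continuous_on_add continuous_on_const linear_continuous_on L(1))
  then have "continuous_on UNIV (u \<circ> A)"
    using u by (intro continuous_on_compose) (auto simp: continuous_geodetically_convex_def intro: continuous_on_subset)
  then show ?thesis
    using geodetically_convex_similarity[OF _ \<open>k > 0\<close> A B BA] u
    by (auto simp: continuous_geodetically_convex_def)
qed

lemma continuous_geodetically_convex_translation:
  "continuous_geodetically_convex u \<Longrightarrow> continuous_geodetically_convex (u \<circ> heis_mult p)"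
  by (rule continuous_geodetically_convex_similarity[where k=1 and B="heis_mult (- p)"])
    (simp_all add: heis_similarity_translation heis_mult_cancel)

lemma continuous_geodetically_convex_dilation:
  "continuous_geodetically_convex u \<Longrightarrow> r > 0 \<Longrightarrow> continuous_geodetically_convex (u \<circ> heis_dilation r)"
  by (rule continuous_geodetically_convex_similarity[where k=r and B="heis_dilation (1 / r)"])
    (simp_all add: heis_similarity_dilation, auto simp: heis_dilation_def power_divide)

lemma continuous_geodetically_convex_rotation:
  "continuous_geodetically_convex u \<Longrightarrow> continuous_geodetically_convex (u \<circ> heis_rotation \<theta>)"
  by (rule continuous_geodetically_convex_similarity[where k=1 and B="heis_rotation (- \<theta>)"])
    (simp_all add: heis_similarity_rotation heis_rotation_cancel)

lemma continuous_geodetically_convex_reflection: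
  "continuous_geodetically_convex u \<Longrightarrow> continuous_geodetically_convex (u \<circ> heis_reflection)"
  by (rule continuous_geodetically_convex_similarity[where k=1 and B=heis_reflection])
    (auto simp: heis_similarity_reflection, auto simp: heis_reflection_def)

section \<open>Short arcs of helices are geodesics\<close>

text \<open>The calibration has the form \<open>F \<bar>z\<bar> - t / 4\<close> with \<open>z = (x, y)\<close>. Its derivative in the
  horizontal direction over \<open>\<zeta>\<close> is the inner product of \<open>\<zeta>\<close> with
  \<open>F' \<bar>z\<bar> \<cdot> z / \<bar>z\<bar> + J z / 2\<close>, where \<open>J (x, y) = (- y, x)\<close>. The two summands are orthogonal, so
  this vector has length one exactly if \<open>(F' \<rho>)\<^sup>2 = 1 - (\<rho> / 2)\<^sup>2\<close>, and the profile \<open>F\<close> below is the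
  solution with \<open>F 0 = 0\<close>. The integral curves of this vector
  field are arcs of the unit circles through the origin.\<close>

definition calibration_profile :: "real \<Rightarrow> real" where
  "calibration_profile \<rho> = (\<rho> / 2) * sqrt (1 - (\<rho> / 2)\<^sup>2) + arcsin (\<rho> / 2)"

definition heis_calibration :: "'n::finite heis \<Rightarrow> real" where
  "heis_calibration p = calibration_profile (norm (heis_proj p)) - snd (snd p) / 4"

definition heis_calibration_deriv :: "'n::finite heis \<Rightarrow> 'n heis \<Rightarrow> real" where
  "heis_calibration_deriv p v =
     sqrt (1 - (norm (heis_proj p) / 2)\<^sup>2) * (heis_proj v \<bullet> sgn (heis_proj p)) - snd (snd v) / 4"

lemma calibration_profile_deriv:
  assumes "-2 < \<rho>" "\<rho> < 2"
  shows "(calibration_profile has_real_derivative sqrt (1 - (\<rho> / 2)\<^sup>2)) (at \<rho>)"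
proof -
  have pos: "1 - (\<rho> / 2)\<^sup>2 > 0"
    using assms abs_square_less_1[of "\<rho> / 2"] by auto
  then have sq: "sqrt (1 - (\<rho> / 2)\<^sup>2) * sqrt (1 - (\<rho> / 2)\<^sup>2) = 1 - (\<rho> / 2)\<^sup>2" "sqrt (1 - (\<rho> / 2)\<^sup>2) > 0"
    by auto
  have "(calibration_profile has_real_derivative
      (1 / 2) * sqrt (1 - (\<rho> / 2)\<^sup>2) + (\<rho> / 2) * (- (\<rho> / 2) * (1 / 2) * inverse (sqrt (1 - (\<rho> / 2)\<^sup>2)))
      + inverse (sqrt (1 - (\<rho> / 2)\<^sup>2)) * (1 / 2)) (at \<rho>)"
    unfolding calibration_profile_def [abs_def]
    using pos assms
    by (auto intro!: derivative_eq_intros simp: power2_eq_square field_simps)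
  moreover have "(1 / 2) * w + (\<rho> / 2) * (- (\<rho> / 2) * (1 / 2) * inverse w) + inverse w * (1 / 2) = w"
    if "w * w = 1 - (\<rho> / 2)\<^sup>2" "w > 0" for w
    using that by (simp add: field_simps power2_eq_square)
  ultimately show ?thesis
    using sq by simp
qed

lemma heis_calibration_has_derivative:
  assumes "0 < norm (heis_proj p)" "norm (heis_proj p) < 2"
  shows "(heis_calibration has_derivative heis_calibration_deriv p) (at p)"
proof -
  have 1: "(heis_proj has_derivative heis_proj) (at p)"
    by (rule bounded_linear_imp_has_derivative[OF bounded_linear_heis_proj])
  have 2: "((\<lambda>q. norm (heis_proj q)) has_derivative (\<lambda>v. heis_proj v \<bullet> sgn (heis_proj p))) (at p)"
    using has_derivative_compose[OF 1 has_derivative_norm[of "heis_proj p"]] assms by simp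
  have 3: "((\<lambda>q. calibration_profile (norm (heis_proj q))) has_derivative
      (\<lambda>v. sqrt (1 - (norm (heis_proj p) / 2)\<^sup>2) * (heis_proj v \<bullet> sgn (heis_proj p)))) (at p)"
    using has_derivative_compose[OF 2, of calibration_profile] calibration_profile_deriv[of "norm (heis_proj p)"] assms
    by (simp add: has_field_derivative_def)
  have 4: "((\<lambda>q. snd (snd q) / 4) has_derivative (\<lambda>v. snd (snd v) / 4)) (at p)"
    by (auto intro!: derivative_eq_intros)
  show ?thesis
    unfolding heis_calibration_def [abs_def] heis_calibration_deriv_def [abs_def]
    using has_derivative_diff[OF 3 4] .
qed

lemma heis_calibration_deriv_bound:
  assumes "norm (heis_proj p) < 2"
  shows "\<bar>heis_calibration_deriv p v\<bar> \<le> 2 * norm v"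
proof -
  have "(norm (heis_proj p) / 2)\<^sup>2 \<le> 1"
    using assms by (intro power_le_one) auto
  then have "\<bar>sqrt (1 - (norm (heis_proj p) / 2)\<^sup>2)\<bar> \<le> 1"
    by (simp add: real_sqrt_le_1_iff)
  moreover have "\<bar>heis_proj v \<bullet> sgn (heis_proj p)\<bar> \<le> norm v"
  proof -
    have "\<bar>heis_proj v \<bullet> sgn (heis_proj p)\<bar> \<le> norm (heis_proj v) * norm (sgn (heis_proj p))"
      by (rule Cauchy_Schwarz_ineq2)
    also have "\<dots> \<le> norm (heis_proj v) * 1"
      by (intro mult_left_mono) (auto simp: norm_sgn)
    finally show ?thesis
      using norm_heis_proj_le[of v] by linarith
  qed
  ultimately have "\<bar>sqrt (1 - (norm (heis_proj p) / 2)\<^sup>2) * (heis_proj v \<bullet> sgn (heis_proj p))\<bar> \<le> 1 * norm v"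
    unfolding abs_mult by (intro mult_mono) auto
  moreover have "\<bar>snd (snd v)\<bar> \<le> norm v"
    using norm_snd_le[of "snd v" "fst v"] norm_snd_le[of "snd (snd v)" "fst (snd v)"] by simp
  ultimately show ?thesis
    unfolding heis_calibration_deriv_def by linarith
qed

text \<open>On horizontal vectors the derivative is the inner product with a unit vector field, called
  \<open>m\<close> in the proof, so the claim is the Cauchy-Schwarz inequality.\<close>

lemma heis_calibration_deriv_horizontal:
  fixes p v :: "'n::finite heis"
  assumes "0 < norm (heis_proj p)" "norm (heis_proj p) < 2" "v \<in> horizontal_space p"
  shows "heis_calibration_deriv p v \<le> norm (heis_proj v)"
proof -
  obtain x y t where p: "p = (x, y, t)" by (cases p)
  obtain \<xi> \<eta> \<tau> where v: "v = (\<xi>, \<eta>, \<tau>)" by (cases v)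
  define \<rho> where "\<rho> = norm (x, y)"
  define c where "c = sqrt (1 - (\<rho> / 2)\<^sup>2)"
  define m where "m = (1 / 2) *\<^sub>R (- y, x) + (c / \<rho>) *\<^sub>R (x, y)"
  have \<rho>: "0 < \<rho>" "\<rho> < 2"
    using assms by (auto simp: \<rho>_def p heis_proj_def)
  have "(\<rho> / 2)\<^sup>2 \<le> 1"
    using \<rho> by (intro power_le_one) auto
  then have c: "c\<^sup>2 = 1 - (\<rho> / 2)\<^sup>2"
    by (simp add: c_def)
  have xy: "x \<bullet> x + y \<bullet> y = \<rho>\<^sup>2"
    by (simp add: \<rho>_def power2_norm_eq_inner)
  have \<tau>: "\<tau> = 2 * (\<xi> \<bullet> y - \<eta> \<bullet> x)"
    using assms(3) by (simp add: p v horizontal_space_inner)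
  have "m \<bullet> m = (1 / 4) * (x \<bullet> x + y \<bullet> y) + (c / \<rho>)\<^sup>2 * (x \<bullet> x + y \<bullet> y)"
    by (simp add: m_def inner_add_left inner_add_right inner_diff_left inner_diff_right
        inner_commute power2_eq_square algebra_simps add_divide_distrib)
  also have "\<dots> = 1"
    using \<rho> by (simp add: xy power_divide c)
  finally have "norm m = 1"
    by (simp add: norm_eq_1)
  have "heis_calibration_deriv p v = c * ((\<xi>, \<eta>) \<bullet> ((1 / \<rho>) *\<^sub>R (x, y))) - \<tau> / 4"
    by (simp only: heis_calibration_deriv_def p v heis_proj_def sgn_div_norm \<rho>_def c_def inverse_eq_divide
        prod.case snd_conv)
  also have "\<dots> = (\<xi>, \<eta>) \<bullet> m"
    by (simp add: m_def \<tau> inner_add_right inner_diff_right inner_commute algebra_simps add_divide_distrib diff_divide_distrib)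
  also have "\<dots> \<le> norm (\<xi>, \<eta>) * norm m"
    by (rule norm_cauchy_schwarz)
  finally show ?thesis
    using \<open>norm m = 1\<close> by (simp add: v heis_proj_def)
qed

text \<open>The horizontal lift of the unit circle centred at \<open>(- e, 0)\<close>, started at the origin with
  velocity \<open>(0, e)\<close>.\<close>

definition heis_arc :: "real ^ 'n \<Rightarrow> real \<Rightarrow> 'n::finite heis" where
  "heis_arc e s = ((cos s - 1) *\<^sub>R e, sin s *\<^sub>R e, 2 * sin s - 2 * s)"

definition heis_arc_velocity :: "real ^ 'n \<Rightarrow> real \<Rightarrow> 'n::finite heis" where
  "heis_arc_velocity e s = (- sin s *\<^sub>R e, cos s *\<^sub>R e, 2 * cos s - 2)"

lemma heis_arc_deriv: "(heis_arc e has_vector_derivative heis_arc_velocity e s) (at s within A)"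
  unfolding heis_arc_def [abs_def] heis_arc_velocity_def
  by (intro has_vector_derivative_Pair)
    (auto intro!: derivative_eq_intros simp: has_real_derivative_iff_has_vector_derivative[symmetric])

lemma heis_arc_velocity_horizontal:
  assumes "norm e = 1"
  shows "heis_arc_velocity e s \<in> horizontal_space (heis_arc e s)"
proof -
  have "e \<bullet> e = 1"
    using assms by (simp add: dot_square_norm)
  then show ?thesis
    using sin_cos_squared_add3[of s]
    by (simp add: heis_arc_def heis_arc_velocity_def horizontal_space_inner algebra_simps)
qed

lemma norm_heis_proj_heis_arc_velocity:
  assumes "norm e = 1"
  shows "norm (heis_proj (heis_arc_velocity e s)) = 1"
  using assms by (simp add: heis_proj_def heis_arc_velocity_def norm_Pair power_mult_distrib)

lemma heis_arc_horizontal: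
  fixes e :: "real ^ 'n::finite"
  assumes "norm e = 1" "a \<le> b"
  shows "horizontal_curve a b (heis_arc e)"
    and "heis_length a b (heis_arc e) = b - a"
    and "constant_speed a b (heis_arc e)"
proof -
  have "abs_continuous_on a b (heis_arc e)"
  proof (rule abs_continuous_on_lipschitz[of 6])
    fix s t assume "s \<in> {a..b}" "t \<in> {a..b}"
    have "norm (heis_arc e s - heis_arc e t) \<le> 6 * norm (s - t)"
    proof (rule differentiable_bound[of UNIV])
      fix s :: real
      show "(heis_arc e has_derivative (\<lambda>h. h *\<^sub>R heis_arc_velocity e s)) (at s within UNIV)"
        using heis_arc_deriv by (simp add: has_vector_derivative_def)
      have "norm (heis_arc_velocity e s) \<le> norm (- sin s *\<^sub>R e) + (norm (cos s *\<^sub>R e) + norm (2 * cos s - 2))"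
        unfolding heis_arc_velocity_def by (meson add_left_mono norm_Pair_le order_trans)
      also have "\<dots> \<le> 1 + (1 + 4)"
      proof (intro add_mono)
        show "norm (2 * cos s - 2) \<le> 4"
          using cos_ge_minus_one[of s] cos_le_one[of s] unfolding real_norm_def by linarith
      qed (use assms(1) in simp_all)
      finally have "norm (heis_arc_velocity e s) \<le> 6" by simp
      then show "onorm (\<lambda>h. h *\<^sub>R heis_arc_velocity e s) \<le> 6"
        by (intro onorm_le) (auto simp: mult.commute intro: mult_left_mono)
    qed auto
    then show "norm (heis_arc e s - heis_arc e t) \<le> 6 * \<bar>s - t\<bar>" by simp
  qed simp
  then show hc: "horizontal_curve a b (heis_arc e)"
    using assms heis_arc_deriv heis_arc_velocity_horizontal unfolding horizontal_curve_def by (metis (mono_tags, lifting) AE_I2)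
  have N: "negligible {a, b}"
    by simp
  have speed: "heis_speed a b (heis_arc e) s = 1" if "s \<in> {a..b} - {a, b}" for s
    using that heis_speed_eq[OF _ _ heis_arc_deriv, of a s b e] norm_heis_proj_heis_arc_velocity[OF assms(1)] by auto
  have "(heis_speed a b (heis_arc e) has_integral (b - a)) {a..b}"
    using has_integral_spike[OF N speed has_integral_const_real[of 1 a b]] assms(2) by simp
  then show "heis_length a b (heis_arc e) = b - a"
    using heis_speed_has_integral[OF hc] has_integral_unique by blast
  have "AE s in lebesgue. s \<notin> {a, b}"
    using N AE_not_in negligible_iff_null_sets by blast
  then have "AE s\<in>{a..b} in lebesgue. heis_speed a b (heis_arc e) s = 1"
    by (rule eventually_mono) (use speed in auto)
  then show "constant_speed a b (heis_arc e)"
    by (auto simp: constant_speed_def)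
qed

lemma norm_heis_proj_heis_arc:
  assumes "norm e = 1" "0 \<le> s" "s \<le> 2 * pi"
  shows "norm (heis_proj (heis_arc e s)) = 2 * sin (s / 2)"
proof -
  have "(1 - cos s)\<^sup>2 + (sin s)\<^sup>2 = 2 - 2 * cos s"
    using sin_cos_squared_add[of s] by (simp add: power2_eq_square algebra_simps)
  also have "\<dots> = (2 * sin (s / 2))\<^sup>2"
    using cos_double_sin[of "s / 2"] by (simp add: power_mult_distrib)
  finally have *: "(1 - cos s)\<^sup>2 + (sin s)\<^sup>2 = (2 * sin (s / 2))\<^sup>2" .
  have "sin (s / 2) \<ge> 0"
    using assms by (intro sin_ge_zero) auto
  then show ?thesis
    using assms(1) by (simp add: heis_proj_def heis_arc_def norm_Pair * real_sqrt_mult)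
qed

text \<open>Equality in the calibration: along the arc the calibration measures exactly the arc
  length, because the arc is an integral curve of the calibrating unit field. The half angle
  \<open>s / 2\<close> enters since the chord that belongs to the angle \<open>s\<close> has length \<open>2 * sin (s / 2)\<close>.\<close>

lemma heis_calibration_heis_arc:
  assumes "norm e = 1" "0 \<le> s" "s \<le> pi"
  shows "heis_calibration (heis_arc e s) = s"
proof -
  have "cos (s / 2) \<ge> 0"
    using assms by (intro cos_ge_zero) auto
  then have "sqrt (1 - (sin (s / 2))\<^sup>2) = cos (s / 2)"
    by (simp add: cos_squared_eq[symmetric])
  moreover have "arcsin (sin (s / 2)) = s / 2"
    using assms by (intro arcsin_sin) auto
  ultimately have "calibration_profile (2 * sin (s / 2)) = sin (s / 2) * cos (s / 2) + s / 2"
    by (simp add: calibration_profile_def)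
  moreover have "sin s = 2 * sin (s / 2) * cos (s / 2)"
    using sin_double[of "s / 2"] by simp
  moreover have "norm (heis_proj (heis_arc e s)) = 2 * sin (s / 2)"
    using assms by (intro norm_heis_proj_heis_arc) auto
  ultimately show ?thesis
    by (simp add: heis_calibration_def heis_arc_def[of e s, THEN arg_cong[of _ _ "\<lambda>p. snd (snd p)"]] field_simps)
qed

text \<open>The arc starts at the angle \<open>\<pi> / 3\<close> because its projection then has norm one: a
  competitor of length less than \<open>1\<close> stays over the unit ball around that point, hence over
  \<open>0 < \<bar>z\<bar> < 2\<close>, where the calibration is smooth. The calibration shows that such a competitor
  cannot reach the other end point.\<close>

lemma heis_arc_geodesic:
  fixes e :: "real ^ 'n::finite"
  assumes e: "norm e = 1"
  shows "heis_geodesic (pi/3) (pi/3 + 1) (heis_arc e) (heis_arc e (pi/3)) (heis_arc e (pi/3 + 1))"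
  unfolding heis_geodesic_def
proof (intro conjI allI impI refl; (elim conjE)?)
  show "horizontal_curve (pi/3) (pi/3 + 1) (heis_arc e)"
    using e by (intro heis_arc_horizontal) auto
  fix c d and \<Delta> :: "real \<Rightarrow> 'n heis"
  assume hc: "horizontal_curve c d \<Delta>" and ends: "\<Delta> c = heis_arc e (pi/3)" "\<Delta> d = heis_arc e (pi/3 + 1)"
  have len: "heis_length (pi/3) (pi/3 + 1) (heis_arc e) = 1"
    using heis_arc_horizontal(2)[OF e, of "pi/3" "pi/3 + 1"] by simp
  have "heis_length c d \<Delta> \<ge> 1"
  proof (rule ccontr)
    assume "\<not> heis_length c d \<Delta> \<ge> 1"
    define z where "z = heis_proj (heis_arc e (pi/3))"
    have z: "norm z = 1"
      using norm_heis_proj_heis_arc[OF e, of "pi/3"] by (simp add: z_def sin_30)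
    define W :: "'n heis set" where "W = heis_proj -` ball z 1"
    have W: "0 < norm (heis_proj p)" "norm (heis_proj p) < 2" if "p \<in> W" for p
    proof -
      have "norm (z - heis_proj p) < 1"
        using that by (simp add: W_def dist_norm)
      then show "0 < norm (heis_proj p)" "norm (heis_proj p) < 2"
        using z norm_triangle_sub[of z "heis_proj p"] norm_triangle_sub[of "heis_proj p" z]
        by (auto simp: norm_minus_commute)
    qed
    have "heis_calibration (\<Delta> d) - heis_calibration (\<Delta> c) \<le> heis_length c d \<Delta>"
      using hc
    proof (rule calibration_le_heis_length[where W=W and S'=heis_calibration_deriv and B=2])
      show "\<Delta> s \<in> W" if "s \<in> {c..d}" for s
        using norm_heis_proj_diff_le_length[OF hc that] \<open>\<not> heis_length c d \<Delta> \<ge> 1\<close>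
        by (simp add: W_def z_def ends dist_norm norm_minus_commute)
      show "convex W"
        unfolding W_def
        by (intro convex_linear_vimage bounded_linear.linear[OF bounded_linear_heis_proj] convex_ball)
      show "onorm (heis_calibration_deriv p) \<le> 2" if "p \<in> W" for p
        using heis_calibration_deriv_bound[OF W(2)[OF that]] by (intro onorm_le) simp
    qed (use W in \<open>auto intro: heis_calibration_has_derivative heis_calibration_deriv_horizontal\<close>)
    moreover have "pi / 3 + 1 \<le> pi"
      using pi_gt3 by simp
    ultimately show False
      using \<open>\<not> heis_length c d \<Delta> \<ge> 1\<close> e
      by (simp add: ends heis_calibration_heis_arc)
  qed
  with len show "heis_length (pi/3) (pi/3 + 1) (heis_arc e) \<le> heis_length c d \<Delta>"
    by simp
qed

section \<open>Convexity along helices\<close>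

text \<open>The lift of the whole unit circle around the origin, traversed over all of \<open>\<real>\<close>. A
  rotation combined with a vertical translation moves it along itself; that is why one geodesic
  arc makes every part of length one of it a geodesic.\<close>

definition heis_helix :: "real ^ 'n \<Rightarrow> real \<Rightarrow> 'n::finite heis" where
  "heis_helix e s = (cos s *\<^sub>R e, sin s *\<^sub>R e, - 2 * s)"

lemma heis_helix_eq_moved_arc:
  "heis_helix e (s + \<theta>) = heis_mult (0, 0, - 2 * \<theta>) (heis_rotation \<theta> (heis_mult (e, 0, 0) (heis_arc e s)))"
    if "norm e = 1"
proof -
  have "e \<bullet> e = 1"
    using that by (simp add: norm_eq_1)
  then show ?thesis
    by (simp add: heis_helix_def heis_rotation_def heis_mult_inner heis_arc_def cos_add sin_add algebra_simps)
qed

lemma heis_helix_midpoint_convex: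
  assumes u: "continuous_geodetically_convex u" and e: "norm e = 1"
  shows "2 * u (heis_helix e (s + 1/2)) \<le> u (heis_helix e s) + u (heis_helix e (s + 1))"
proof -
  define \<theta> where "\<theta> = s - pi/3"
  define v where "v = u \<circ> heis_mult (0, 0, - 2 * \<theta>) \<circ> heis_rotation \<theta> \<circ> heis_mult (e, 0, 0)"
  have "continuous_geodetically_convex v"
    unfolding v_def
    by (intro continuous_geodetically_convex_translation continuous_geodetically_convex_rotation u)
  then have "convex_on {pi/3..pi/3 + 1} (v \<circ> heis_arc e)"
    using heis_arc_geodesic[OF e] heis_arc_horizontal(3)[OF e, of "pi/3" "pi/3 + 1", simplified]
    unfolding continuous_geodetically_convex_def geodetically_convex_def by blast
  from convex_onD[OF this, of "1/2" "pi/3" "pi/3 + 1"]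
  have "2 * v (heis_arc e (pi/3 + 1/2)) \<le> v (heis_arc e (pi/3)) + v (heis_arc e (pi/3 + 1))"
    by (simp add: field_simps)
  moreover have "v (heis_arc e r) = u (heis_helix e (r + \<theta>))" for r
    by (simp add: v_def heis_helix_eq_moved_arc[OF e])
  ultimately show ?thesis
    by (simp add: \<theta>_def algebra_simps)
qed

lemma discrete_convex_first_increment:
  fixes g :: "nat \<Rightarrow> real"
  assumes "\<And>k. 2 * g (Suc k) \<le> g k + g (Suc (Suc k))"
  shows "n * (g 1 - g 0) \<le> g n - g 0"
proof -
  have inc: "g 1 - g 0 \<le> g (Suc k) - g k" for k
  proof (induction k)
    case (Suc k)
    then show ?case using assms[of k] by simp
  qed simp
  show ?thesis
  proof (induction n)
    case (Suc n)
    then show ?case using inc[of n] by (simp add: algebra_simps)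
  qed simp
qed

text \<open>A convex sequence that is bounded by \<open>M\<close> over \<open>n\<close> steps in both directions can change by
  at most \<open>2 * M / n\<close> in its first step. The increment from \<open>-1/4\<close> to \<open>1/4\<close> is centred, so that
  the chord between the two points lies in the direction \<open>(0, e)\<close>.\<close>

lemma heis_helix_increment_bound:
  assumes u: "continuous_geodetically_convex u" and e: "norm e = 1" and "n > 0"
    and M: "\<And>s. \<bar>s\<bar> \<le> real n \<Longrightarrow> \<bar>u (heis_helix e s)\<bar> \<le> M"
  shows "\<bar>u (heis_helix e (1/4)) - u (heis_helix e (-1/4))\<bar> \<le> 2 * M / n"
proof -
  \<comment> \<open>Running along the helix in both directions bounds the increment from above and below.\<close>
  define g where "g k = u (heis_helix e (real k / 2 - 1/4))" for k
  define h where "h k = u (heis_helix e (1/4 - real k / 2))" for k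
  have "2 * g (Suc k) \<le> g k + g (Suc (Suc k))" for k
    using heis_helix_midpoint_convex[OF u e, of "real k / 2 - 1/4"] by (simp add: g_def add_divide_distrib algebra_simps)
  then have "n * (g 1 - g 0) \<le> g n - g 0"
    by (rule discrete_convex_first_increment)
  moreover have "2 * h (Suc k) \<le> h k + h (Suc (Suc k))" for k
    using heis_helix_midpoint_convex[OF u e, of "1/4 - real (Suc (Suc k)) / 2"]
    by (simp add: h_def add_divide_distrib algebra_simps)
  then have "n * (h 1 - h 0) \<le> h n - h 0"
    by (rule discrete_convex_first_increment)
  moreover have "\<bar>g n\<bar> \<le> M" "\<bar>g 0\<bar> \<le> M" "\<bar>h n\<bar> \<le> M" "\<bar>h 0\<bar> \<le> M"
    unfolding g_def h_def using \<open>n > 0\<close> by (auto intro!: M)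
  moreover have "h 1 = g 0" "h 0 = g 1"
    by (simp_all add: g_def h_def)
  ultimately have "n * (g 1 - g 0) \<le> 2 * M" "n * (g 0 - g 1) \<le> 2 * M"
    by auto
  then have "n * \<bar>g 1 - g 0\<bar> \<le> 2 * M"
    by (auto simp: abs_if)
  then have "\<bar>g 1 - g 0\<bar> \<le> 2 * M / n"
    using \<open>n > 0\<close> by (simp add: field_simps)
  then show ?thesis
    by (simp add: g_def)
qed

section \<open>Constancy along horizontal lines\<close>

text \<open>A box that contains \<open>2 * n\<close> parameter units of the helix of radius \<open>r\<close>, translated so as to
  pass through the origin. For \<open>r\<close> of order \<open>1 / N\<close> and \<open>n = N\<^sup>2\<close> its size stays bounded: the
  helix rises only by the order of \<open>r\<^sup>2\<close> per turn.\<close>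

definition helix_box :: "real \<Rightarrow> nat \<Rightarrow> 'n::finite heis set" where
  "helix_box r n = {(x, y, t). norm x \<le> 2 * r \<and> norm y \<le> 2 * r \<and> \<bar>t\<bar> \<le> r\<^sup>2 * (5 + 2 * n)}"

text \<open>The increment bound on a helix of radius \<open>r\<close> through \<open>b\<close>, in both orientations: the
  reflected helix has the same chord but the opposite height.\<close>

lemma helix_box_step:
  fixes b :: "'n::finite heis"
  assumes u: "continuous_geodetically_convex u" and e: "norm e = 1" and "n > 0" "r > 0"
    and M: "\<And>q. q \<in> helix_box r n \<Longrightarrow> \<bar>u (heis_mult b q)\<bar> \<le> M"
  shows "\<bar>u (heis_mult b (0, (r * (2 * sin (1/4))) *\<^sub>R e, r\<^sup>2 * (2 * sin (1/2) - 1))) - u b\<bar> \<le> 2 * M / n"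
    and "\<bar>u (heis_mult b (0, (r * (2 * sin (1/4))) *\<^sub>R e, - (r\<^sup>2 * (2 * sin (1/2) - 1)))) - u b\<bar> \<le> 2 * M / n"
proof -
  define F where "F = heis_dilation r \<circ> heis_mult (- heis_helix e (-1/4))"
  have ee: "e \<bullet> e = 1"
    using e by (simp add: norm_eq_1)
  have F: "F (heis_helix e s) = ((r * (cos s - cos (1/4))) *\<^sub>R e, (r * (sin s + sin (1/4))) *\<^sub>R e,
      r\<^sup>2 * (2 * (cos s * sin (1/4) + cos (1/4) * sin s) - 2 * s - 1/2))" for s
    by (simp add: F_def heis_dilation_def heis_helix_def heis_mult_inner ee algebra_simps)
  have box: "F (heis_helix e s) \<in> helix_box r n" if "\<bar>s\<bar> \<le> real n" for s
  proof -
    have "\<bar>cos s - cos (1/4)\<bar> \<le> 2" "\<bar>sin s + sin (1/4)\<bar> \<le> 2"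
      using abs_cos_le_one[of s] abs_cos_le_one[of "1/4"] abs_sin_le_one[of s] abs_sin_le_one[of "1/4"]
      by linarith+
    moreover have "\<bar>cos s * sin (1/4) + cos (1/4) * sin s\<bar> \<le> 1"
      using abs_sin_le_one[of "s + 1/4"] by (simp add: sin_add algebra_simps)
    moreover have "\<bar>2 * w - 2 * s - 1/2\<bar> \<le> 5 + 2 * real n" if "\<bar>w\<bar> \<le> 1" for w
      using that \<open>\<bar>s\<bar> \<le> real n\<close> by linarith
    ultimately have "\<bar>cos s - cos (1/4)\<bar> \<le> 2" "\<bar>sin s + sin (1/4)\<bar> \<le> 2"
      "\<bar>2 * (cos s * sin (1/4) + cos (1/4) * sin s) - 2 * s - 1/2\<bar> \<le> 5 + 2 * real n"
      by blast+
    then show ?thesis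
      using \<open>r > 0\<close> e by (simp add: F helix_box_def abs_mult)
  qed
  have F0: "F (heis_helix e (-1/4)) = (0, 0, 0)"
    by (simp add: F)
  have cs: "cos (1/4) * sin (1/4) + cos (1/4) * sin (1/4) = sin (1/2 :: real)"
    using sin_double[of "1/4 :: real"] by simp
  have F1: "F (heis_helix e (1/4)) = (0, (r * (2 * sin (1/4))) *\<^sub>R e, r\<^sup>2 * (2 * sin (1/2) - 1))"
    by (simp add: F cs)
  have b0: "heis_mult b (0, 0, 0) = b"
    by (cases b) (simp add: heis_mult_inner)
  have "continuous_geodetically_convex (u \<circ> heis_mult b \<circ> heis_dilation r \<circ> heis_mult (- heis_helix e (-1/4)))"
    by (intro continuous_geodetically_convex_translation continuous_geodetically_convex_dilation u \<open>r > 0\<close>)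
  from heis_helix_increment_bound[OF this e \<open>n > 0\<close>, of M]
  show "\<bar>u (heis_mult b (0, (r * (2 * sin (1/4))) *\<^sub>R e, r\<^sup>2 * (2 * sin (1/2) - 1))) - u b\<bar> \<le> 2 * M / n"
    using M box F0 F1 b0 by (simp add: F_def)
  have "continuous_geodetically_convex
      (u \<circ> heis_mult b \<circ> heis_reflection \<circ> heis_dilation r \<circ> heis_mult (- heis_helix e (-1/4)))"
    by (intro continuous_geodetically_convex_translation continuous_geodetically_convex_dilation
        continuous_geodetically_convex_reflection u \<open>r > 0\<close>)
  from heis_helix_increment_bound[OF this e \<open>n > 0\<close>, of M]
  have *: "(\<And>s. \<bar>s\<bar> \<le> real n \<Longrightarrow> \<bar>u (heis_mult b (heis_reflection (F (heis_helix e s))))\<bar> \<le> M) \<Longrightarrow>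
    \<bar>u (heis_mult b (heis_reflection (F (heis_helix e (1/4))))) - u (heis_mult b (heis_reflection (F (heis_helix e (-1/4)))))\<bar>
      \<le> 2 * M / n"
    by (simp add: F_def)
  have "heis_reflection q \<in> helix_box r n" if "q \<in> helix_box r n" for q :: "'n heis"
    using that by (cases q) (simp add: helix_box_def heis_reflection_def)
  then have "\<bar>u (heis_mult b (heis_reflection (F (heis_helix e (1/4))))) - u (heis_mult b (heis_reflection (F (heis_helix e (-1/4)))))\<bar>
      \<le> 2 * M / n"
    using M box by (intro *) blast
  moreover have "heis_reflection (F (heis_helix e (-1/4))) = (0, 0, 0)"
    unfolding F0 by (simp add: heis_reflection_def)
  moreover have "heis_reflection (F (heis_helix e (1/4))) = (0, (r * (2 * sin (1/4))) *\<^sub>R e, - (r\<^sup>2 * (2 * sin (1/2) - 1)))"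
    unfolding F1 by (simp add: heis_reflection_def)
  ultimately show "\<bar>u (heis_mult b (0, (r * (2 * sin (1/4))) *\<^sub>R e, - (r\<^sup>2 * (2 * sin (1/2) - 1)))) - u b\<bar> \<le> 2 * M / n"
    by (simp only: b0)
qed

lemma continuous_bounded_on_products:
  fixes u :: "'n::finite heis \<Rightarrow> real"
  assumes "continuous_on UNIV u"
  shows "\<exists>M. \<forall>p q. norm p \<le> R \<longrightarrow> norm q \<le> R \<longrightarrow> \<bar>u (heis_mult p q)\<bar> \<le> M"
proof -
  have "continuous_on UNIV (\<lambda>pq. heis_mult (fst pq) (snd pq :: 'n heis))"
    unfolding heis_mult_def by (simp add: case_prod_unfold) (intro continuous_intros)
  then have "continuous_on UNIV (\<lambda>pq. u (heis_mult (fst pq) (snd pq)))"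
    by (rule continuous_on_compose2[OF assms]) auto
  then have "compact ((\<lambda>pq. u (heis_mult (fst pq) (snd pq))) ` (cball 0 R \<times> cball 0 R))"
    by (intro compact_continuous_image compact_Times compact_cball) (auto intro: continuous_on_subset)
  then have "bounded ((\<lambda>pq. u (heis_mult (fst pq) (snd pq))) ` (cball 0 R \<times> cball 0 R))"
    by (rule compact_imp_bounded)
  then obtain M where M: "\<And>x. x \<in> (\<lambda>pq. u (heis_mult (fst pq) (snd pq))) ` (cball 0 R \<times> cball 0 R) \<Longrightarrow> norm x \<le> M"
    unfolding bounded_iff by blast
  have "\<bar>u (heis_mult p q)\<bar> \<le> M" if "norm p \<le> R" "norm q \<le> R" for p q
    using M[of "u (heis_mult p q)"] that by force
  then show ?thesis by blast
qed

lemma norm_heis_le: "norm (x, y, t) \<le> norm x + norm y + \<bar>t :: real\<bar>"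
  using norm_Pair_le[of x "(y, t)"] norm_Pair_le[of y t] by simp

text \<open>The segment from \<open>(0, 0, 0)\<close> to \<open>(0, l e, 0)\<close> is cut into \<open>N\<close> pieces. Each piece is the
  product of two helix steps of opposite orientation and radius \<open>r / N\<close>, whose heights cancel, and
  each step changes \<open>u\<close> by at most \<open>2 M / N\<^sup>2\<close> with \<open>M\<close> independent of \<open>N\<close>. The total change
  \<open>4 M / N\<close> tends to zero.\<close>

lemma constant_on_Y_line_from_origin:
  fixes u :: "'n::finite heis \<Rightarrow> real"
  assumes u: "continuous_geodetically_convex u" and e: "norm e = 1" and "l > 0"
  shows "u (0, l *\<^sub>R e, 0) = u (0, 0, 0)"
proof -
  define \<rho> :: real where "\<rho> = 2 * sin (1/4)"
  define \<kappa> :: real where "\<kappa> = 2 * sin (1/2) - 1"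
  have "\<rho> > 0"
    unfolding \<rho>_def using pi_gt3 by (simp add: sin_gt_zero)
  define r where "r = l / (2 * \<rho>)"
  have "r > 0"
    using \<open>l > 0\<close> \<open>\<rho> > 0\<close> by (simp add: r_def)
  define R where "R = max (l + r\<^sup>2 * \<bar>\<kappa>\<bar>) (4 * r + 7 * r\<^sup>2)"
  obtain M where M: "\<And>p q. norm p \<le> R \<Longrightarrow> norm q \<le> R \<Longrightarrow> \<bar>u (heis_mult p q)\<bar> \<le> M"
    using continuous_bounded_on_products[of u R] u unfolding continuous_geodetically_convex_def by metis
  have bound: "real N * \<bar>u (0, l *\<^sub>R e, 0) - u (0, 0, 0)\<bar> \<le> 4 * M" if "N > 0" for N :: nat
  proof -
    define rN where "rN = r / N"
    have rN: "0 < rN" "rN \<le> r" "rN * \<rho> = l / (2 * N)" "rN\<^sup>2 \<le> r\<^sup>2" "rN\<^sup>2 * (N\<^sup>2) = r\<^sup>2"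
    proof -
      show "0 < rN" "rN \<le> r"
        using that \<open>r > 0\<close> by (auto simp: rN_def field_simps)
      then show "rN\<^sup>2 \<le> r\<^sup>2"
        by (intro power_mono) auto
      show "rN * \<rho> = l / (2 * N)" "rN\<^sup>2 * (N\<^sup>2) = r\<^sup>2"
        using that \<open>\<rho> > 0\<close> by (auto simp: rN_def r_def power_divide power_mult_distrib)
    qed
    have box: "norm q \<le> R" if "q \<in> helix_box rN (N\<^sup>2)" for q :: "'n heis"
    proof -
      obtain x y t where q: "q = (x, y, t)" by (cases q)
      have "norm x \<le> 2 * rN" "norm y \<le> 2 * rN" "\<bar>t\<bar> \<le> 5 * rN\<^sup>2 + 2 * (rN\<^sup>2 * N\<^sup>2)"
        using that by (auto simp: q helix_box_def algebra_simps)
      then have "norm x + norm y + \<bar>t\<bar> \<le> 4 * r + 7 * r\<^sup>2"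
        using rN by linarith
      then show ?thesis
        using norm_heis_le[of x y t] by (simp add: q R_def)
    qed
    have step: "\<bar>u (heis_mult b (0, (rN * \<rho>) *\<^sub>R e, rN\<^sup>2 * \<kappa>)) - u b\<bar> \<le> 2 * M / N\<^sup>2"
        "\<bar>u (heis_mult b (0, (rN * \<rho>) *\<^sub>R e, - (rN\<^sup>2 * \<kappa>))) - u b\<bar> \<le> 2 * M / N\<^sup>2"
      if "norm b \<le> R" for b
      unfolding \<rho>_def \<kappa>_def
      using helix_box_step[OF u e _ rN(1), of "N\<^sup>2" b M] M[OF that] box \<open>N > 0\<close> by auto
    \<comment> \<open>\<open>b k\<close> are the division points of the segment, \<open>b' k\<close> the intermediate points between the
      two steps that join \<open>b k\<close> to \<open>b (Suc k)\<close>.\<close>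
    define b where "b k = (0 :: real ^ 'n, (k * l / N) *\<^sub>R e, 0 :: real)" for k :: nat
    define b' where "b' k = (0 :: real ^ 'n, (k * l / N + rN * \<rho>) *\<^sub>R e, rN\<^sup>2 * \<kappa>)" for k :: nat
    have b': "b' k = heis_mult (b k) (0, (rN * \<rho>) *\<^sub>R e, rN\<^sup>2 * \<kappa>)" for k
      by (simp add: b_def b'_def heis_mult_inner algebra_simps)
    have inc: "k * l / N + rN * \<rho> + rN * \<rho> = Suc k * l / N" for k
      using \<open>N > 0\<close> unfolding rN(3) by (simp add: field_simps)
    have bS: "b (Suc k) = heis_mult (b' k) (0, (rN * \<rho>) *\<^sub>R e, - (rN\<^sup>2 * \<kappa>))" for k
      unfolding b_def b'_def by (simp add: heis_mult_inner inc[symmetric] scaleR_add_left[symmetric] del: of_nat_Suc)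
    have nb: "norm (b k) \<le> R" "norm (b' k) \<le> R" if "k < N" for k
    proof -
      have "Suc k * l / N \<le> l"
        using \<open>k < N\<close> \<open>l > 0\<close> by (simp add: divide_le_eq mult_right_mono)
      moreover have "k * l / N + 2 * (rN * \<rho>) = Suc k * l / N"
        using inc[of k] by linarith
      moreover have "rN * \<rho> > 0" "k * l / N \<ge> 0"
        using rN(1) \<open>\<rho> > 0\<close> \<open>l > 0\<close> by auto
      ultimately have "k * l / N \<le> l" "k * l / N + rN * \<rho> \<le> l" "k * l / N \<ge> 0" "k * l / N + rN * \<rho> \<ge> 0"
        by linarith+
      moreover have "\<bar>rN\<^sup>2 * \<kappa>\<bar> \<le> r\<^sup>2 * \<bar>\<kappa>\<bar>"
        using rN(4) by (simp add: abs_mult mult_right_mono)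
      moreover have "r\<^sup>2 * \<bar>\<kappa>\<bar> \<ge> 0" by simp
      ultimately show "norm (b k) \<le> R" "norm (b' k) \<le> R"
        using e norm_heis_le[of "0 :: real ^ 'n" "(k * l / N) *\<^sub>R e" 0]
          norm_heis_le[of "0 :: real ^ 'n" "(k * l / N + rN * \<rho>) *\<^sub>R e" "rN\<^sup>2 * \<kappa>"]
        unfolding b_def b'_def R_def norm_scaleR by auto
    qed
    have "\<bar>u (b (Suc k)) - u (b k)\<bar> \<le> 4 * M / N\<^sup>2" if "k < N" for k
    proof -
      have "4 * M / N\<^sup>2 = 2 * M / N\<^sup>2 + 2 * M / N\<^sup>2"
        by (simp add: add_divide_distrib[symmetric])
      then show ?thesis
        using step(1)[OF nb(1)[OF that]] step(2)[OF nb(2)[OF that]]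
        unfolding b'[symmetric] bS[symmetric] by linarith
    qed
    then have "\<bar>\<Sum>k<N. u (b (Suc k)) - u (b k)\<bar> \<le> (\<Sum>k<N. 4 * M / N\<^sup>2)"
      by (intro order_trans[OF sum_abs sum_mono]) auto
    then have "\<bar>u (b N) - u (b 0)\<bar> \<le> N * (4 * M / N\<^sup>2)"
      by (simp add: sum_lessThan_telescope[of "\<lambda>k. u (b k)" N])
    then have "\<bar>u (0, l *\<^sub>R e, 0) - u (0, 0, 0)\<bar> \<le> 4 * M / N"
      using that by (simp add: b_def power2_eq_square)
    then show ?thesis
      using that by (simp add: field_simps)
  qed
  have "\<bar>u (0, l *\<^sub>R e, 0) - u (0, 0, 0)\<bar> \<le> 0"
  proof (rule ccontr)
    assume "\<not> ?thesis"
    then obtain N :: nat where N: "4 * M < N * \<bar>u (0, l *\<^sub>R e, 0) - u (0, 0, 0)\<bar>"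
      using reals_Archimedean3[of "\<bar>u (0, l *\<^sub>R e, 0) - u (0, 0, 0)\<bar>"] by auto
    have "4 * M < real (Suc N) * \<bar>u (0, l *\<^sub>R e, 0) - u (0, 0, 0)\<bar>"
      using N by (simp add: algebra_simps)
    with bound[of "Suc N"] show False
      by simp
  qed
  then show ?thesis
    by simp
qed

lemma heis_mult_zero: "heis_mult p (0, 0, 0) = p"
  by (cases p) (simp add: heis_mult_inner)

lemma constant_along_Y:
  assumes u: "continuous_geodetically_convex u"
  shows "u (heis_mult p (0, a, 0)) = u p"
proof (cases "a = 0")
  case False
  then have "(u \<circ> heis_mult p) (0, norm a *\<^sub>R sgn a, 0) = (u \<circ> heis_mult p) (0, 0, 0)"
    by (intro constant_on_Y_line_from_origin continuous_geodetically_convex_translation u) (auto simp: norm_sgn)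
  then show ?thesis
    using False by (simp add: heis_mult_zero sgn_div_norm)
qed (simp add: heis_mult_zero)

text \<open>A rotation by a right angle turns the \<open>y\<close>-directions into the \<open>x\<close>-directions.\<close>

lemma constant_along_X:
  assumes u: "continuous_geodetically_convex u"
  shows "u (heis_mult p (a, 0, 0)) = u p"
proof -
  obtain x y t where p: "p = (x, y, t)" by (cases p)
  have "(u \<circ> heis_rotation (pi/2)) (heis_mult (y, - x, t) (0, - a, 0)) = (u \<circ> heis_rotation (pi/2)) (y, - x, t)"
    by (rule constant_along_Y[OF continuous_geodetically_convex_rotation[OF u]])
  then show ?thesis
    by (simp add: p heis_rotation_def heis_mult_inner inner_commute add.commute)
qed

theorem theorem1p6:
  fixes u :: "'n::finite heis \<Rightarrow> real"
  shows "continuous_on UNIV u \<and> geodetically_convex u \<longleftrightarrow> (\<exists>c. \<forall>p. u p = c)"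
proof
  assume "continuous_on UNIV u \<and> geodetically_convex u"
  then have u: "continuous_geodetically_convex u"
    by (simp add: continuous_geodetically_convex_def)
  note X = constant_along_X[OF u] and Y = constant_along_Y[OF u]
  \<comment> \<open>The commutator of an \<open>x\<close>-translation and a \<open>y\<close>-translation is vertical.\<close>
  have vertical: "u (0, 0, t) = u (0, 0, 0)" for t
  proof -
    obtain e :: "real ^ 'n" where e: "e \<bullet> e = 1"
      using norm_axis_1 by (metis norm_eq_1)
    have "u (0, 0, 0) = u (e, 0, 0)"
      using X[of "(0, 0, 0)" e] by (simp add: heis_mult_inner)
    also have "\<dots> = u (e, - (t / 4) *\<^sub>R e, t / 2)"
      using Y[of "(e, 0, 0)" "- (t / 4) *\<^sub>R e"] by (simp add: heis_mult_inner e)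
    also have "\<dots> = u (0, - (t / 4) *\<^sub>R e, t)"
      using X[of "(e, - (t / 4) *\<^sub>R e, t / 2)" "- e"] by (simp add: heis_mult_inner e)
    also have "\<dots> = u (0, 0, t)"
      using Y[of "(0, - (t / 4) *\<^sub>R e, t)" "(t / 4) *\<^sub>R e"] by (simp add: heis_mult_inner)
    finally show ?thesis by simp
  qed
  have "u (x, y, t) = u (0, 0, 0)" for x y t
    using X[of "(x, y, t)" "- x"] Y[of "(0, y, t - 2 * (x \<bullet> y))" "- y"] vertical[of "t - 2 * (x \<bullet> y)"]
    by (simp add: heis_mult_inner)
  then show "\<exists>c. \<forall>p. u p = c"
    by (intro exI[of _ "u (0, 0, 0)"]) auto
next
  assume "\<exists>c. \<forall>p. u p = c"
  then obtain c where "u = (\<lambda>_. c)" by blast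
  moreover have "convex_on {a..b} ((\<lambda>_. c) \<circ> \<Gamma>)" for a b and \<Gamma> :: "real \<Rightarrow> 'n heis"
    by (simp add: o_def convex_on_const)
  ultimately show "continuous_on UNIV u \<and> geodetically_convex u"
    by (simp add: geodetically_convex_def)
qed

end
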